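(* Let $(x^k)_{k\in\mathbb{N}}$ and $(\alpha_k)_{k\in\mathbb{N}}$ be the sequences generated by the FBS method. Suppose that the solution set $S^*$ is not empty, that $(x^k)_{k\in\mathbb{N}}$ converges to some $x^*\in S^*$, and that $\nabla f$ is locally Lipschitz continuous around $x^*$ with constant $L>0$. If $\partial F=\nabla f+\partial g$ is metrically subregular at $x^*$ for $0$ with modulus $\kappa^{-1}>0$, then there exists $K\in\mathbb{N}$ such that $$\|x^{k+1}-x^*\|\le \frac{1}{\sqrt{1+\frac{\alpha\kappa}{4}}}\,\|x^k-x^*\|,$$ $$|F(x^{k+1})-F(x^* )|\le \frac{\sqrt{1+\frac{\alpha\kappa}{4}}+1}{2\sqrt{1+\frac{\alpha\kappa}{4}}}\,|F(x^{k})-F(x^* )|$$ for any $k>K$, where $\alpha:=\min\big\{\frac{\alpha_K}{2},\frac{\theta}{2L}\big\}$. If, in addition, $\nabla f$ is globally Lipschitz continuous on $\mathrm{int}(\mathrm{dom}\, f)\cap\mathrm{dom}\, g$ with constant $L>0$, then $\alpha$ can be chosen as $\min\big\{\frac{\sigma}{2},\frac{\theta}{2L}\big\}$.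
   Context: $\Gamma_0(\mathbb{R}^n)$ is the set of proper, lower semicontinuous, convex functions $\mathbb{R}^n\to\mathbb{R}\cup\{+\infty\}$; $\partial$ is the convex subdifferential. Problem: minimize $F:=f+g$ over $\mathbb{R}^n$; $S^*$ is its set of optimal solutions. Standing assumptions: (A1) $f,g\in\Gamma_0(\mathbb{R}^n)$ and $\mathrm{int}(\mathrm{dom}\, f)\cap \mathrm{dom}\, g\neq\emptyset$. (A2) For any $x\in\mathrm{int}(\mathrm{dom}\, f)\cap\mathrm{dom}\, g$, the sublevel set $\{F\le F(x)\}$ is contained in $\mathrm{int}(\mathrm{dom}\, f)\cap\mathrm{dom}\, g$, and $f$ is continuously differentiable at any point of $\{F\le F(x)\}$. Proximal operator: $\mathrm{prox}_{g}(z):=(\mathrm{Id}+\partial g)^{-1}(z)$. For $x\in\mathrm{int}(\mathrm{dom}\, f)\cap\mathrm{dom}\, g$ and $\alpha>0$ put $J(x,\alpha):=\mathrm{prox}_{\alpha g}(x-\alpha\nabla f(x))$. Line search $LS(x,\sigma,\theta)$ (Beck–Teboulle), for $\sigma>0$, $\theta\in(0,1)$: start with $\alpha=\sigma$; while $f(J(x,\alpha))>f(x)+\langle\nabla f(x),J(x,\alpha)-x\rangle+\frac{1}{2\alpha}\|x-J(x,\alpha)\|^2$, replace $\alpha$ by $\theta\alpha$; output $\alpha$. FBS method: fix $\sigma>0$, $\theta\in(0,1)$, $x^0\in\mathrm{int}(\mathrm{dom}\, f)\cap\mathrm{dom}\, g$, $\alpha_{-1}:=\sigma$, and for $k=0,1,2,\dots$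 set $\alpha_k:=LS(x^k,\alpha_{k-1},\theta)$ and $x^{k+1}:=J(x^k,\alpha_k)$. $\nabla f$ is locally Lipschitz continuous around $x^*$ with constant $L$ if $\|\nabla f(x)-\nabla f(y)\|\le L\|x-y\|$ for all $x,y$ in some neighborhood of $x^*$. A set-valued mapping $G:\mathbb{R}^n\rightrightarrows\mathbb{R}^m$ is metrically subregular at $\bar x\in\mathrm{dom}\, G$ for $\bar y\in G(\bar x)$ with modulus $\kappa>0$ if there is a neighborhood $U$ of $\bar x$ with $d(x;G^{-1}(\bar y))\le\kappa\, d(\bar y;G(x))$ for all $x\in U$, where $d(x;\Omega)$ is the distance to $\Omega$ and $d(x;\emptyset)=\infty$. *)

theory Defs
  imports "HOL-Analysis.Analysis" "HOL-Library.While_Combinator"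
begin

text \<open>
  Functions with values in \<open>\<real> \<union> {+\<infinity>}\<close> are functions into \<^typ>\<open>ereal\<close> that avoid \<open>-\<infinity>\<close>;
  set-valued mappings are functions into sets.
\<close>

definition edom :: "('a \<Rightarrow> ereal) \<Rightarrow> 'a set" where
  "edom f = {x. f x < \<infinity>}"

definition proper_fun :: "('a \<Rightarrow> ereal) \<Rightarrow> bool" where
  "proper_fun f \<longleftrightarrow> (\<forall>x. f x \<noteq> -\<infinity>) \<and> (\<exists>x. f x \<noteq> \<infinity>)"

definition lsc_fun :: "('a::topological_space \<Rightarrow> ereal) \<Rightarrow> bool" where
  "lsc_fun f \<longleftrightarrow> (\<forall>x. f x \<le> Liminf (at x) f)"

text \<open>In \<^typ>\<open>ereal\<close> one has \<open>0 * \<infinity> = 0\<close>, so the end points \<open>t = 0\<close> and \<open>t = 1\<close> are harmless.\<close>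

definition convex_fun :: "('a::real_vector \<Rightarrow> ereal) \<Rightarrow> bool" where
  "convex_fun f \<longleftrightarrow> (\<forall>x y. \<forall>t\<in>{0..1}.
     f ((1 - t) *\<^sub>R x + t *\<^sub>R y) \<le> ereal (1 - t) * f x + ereal t * f y)"

definition Gamma0 :: "('a::real_normed_vector \<Rightarrow> ereal) set" where
  "Gamma0 = {f. proper_fun f \<and> lsc_fun f \<and> convex_fun f}"

definition subdiff :: "('a::real_inner \<Rightarrow> ereal) \<Rightarrow> 'a \<Rightarrow> 'a set" where
  "subdiff f x = {v. x \<in> edom f \<and> (\<forall>y. f x + ereal (v \<bullet> (y - x)) \<le> f y)}"

definition inv_map :: "('a \<Rightarrow> 'b set) \<Rightarrow> 'b \<Rightarrow> 'a set" where
  "inv_map G y = {x. y \<in> G x}"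

definition ext_dist :: "'a::metric_space \<Rightarrow> 'a set \<Rightarrow> ereal" where
  \<comment> \<open>The infimum over the empty set is \<open>\<infinity>\<close>, unlike for \<^const>\<open>infdist\<close>.\<close>
  "ext_dist x S = (INF y\<in>S. ereal (dist x y))"

definition metrically_subregular ::
  "('a::metric_space \<Rightarrow> 'b::metric_space set) \<Rightarrow> 'a \<Rightarrow> 'b \<Rightarrow> real \<Rightarrow> bool" where
  "metrically_subregular G xb yb c \<longleftrightarrow> c > 0 \<and> yb \<in> G xb \<and>
     (\<forall>\<^sub>F x in nhds xb. ext_dist x (inv_map G yb) \<le> ereal c * ext_dist yb (G x))"

definition prox :: "('a::real_inner \<Rightarrow> ereal) \<Rightarrow> 'a \<Rightarrow> 'a" where
  \<comment> \<open>For \<open>g \<in> Gamma0\<close> on a Euclidean space, \<open>(Id + \<partial>g)\<inverse>\<close> is single-valued with full domain.\<close>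
  "prox g z = the_elem (inv_map (\<lambda>p. (+) p ` subdiff g p) z)"

text \<open>
  Since \<^const>\<open>real_of_ereal\<close> sends \<open>\<infinity>\<close> to \<open>0\<close>, gradients are meaningful only at interior
  points of the domain; outside of \<open>grad_exists\<close> the value of \<open>grad\<close> is unspecified.
\<close>

definition grad :: "('a::real_inner \<Rightarrow> ereal) \<Rightarrow> 'a \<Rightarrow> 'a" where
  "grad f x = (THE D. GDERIV (\<lambda>y. real_of_ereal (f y)) x :> D)"

definition grad_exists :: "('a::real_inner \<Rightarrow> ereal) \<Rightarrow> 'a \<Rightarrow> bool" where
  "grad_exists f x \<longleftrightarrow>
     x \<in> interior (edom f) \<and> (\<exists>D. GDERIV (\<lambda>y. real_of_ereal (f y)) x :> D)"

definition cont_differentiable_at :: "('a::real_inner \<Rightarrow> ereal) \<Rightarrow> 'a \<Rightarrow> bool" where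
  "cont_differentiable_at f x \<longleftrightarrow> (\<forall>\<^sub>F y in nhds x. grad_exists f y) \<and> isCont (grad f) x"

definition locally_lipschitz_around ::
  "real \<Rightarrow> ('a::metric_space \<Rightarrow> 'b::metric_space) \<Rightarrow> 'a \<Rightarrow> bool" where
  "locally_lipschitz_around L h x \<longleftrightarrow> (\<exists>U. open U \<and> x \<in> U \<and> L-lipschitz_on U h)"

definition objective :: "('a \<Rightarrow> ereal) \<Rightarrow> ('a \<Rightarrow> ereal) \<Rightarrow> 'a \<Rightarrow> ereal" where
  "objective f g = (\<lambda>x. f x + g x)"

definition solution_set :: "('a \<Rightarrow> ereal) \<Rightarrow> ('a \<Rightarrow> ereal) \<Rightarrow> 'a set" where
  "solution_set f g = {x. \<forall>y. objective f g x \<le> objective f g y}"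

definition fb_step :: "('a::real_inner \<Rightarrow> ereal) \<Rightarrow> ('a \<Rightarrow> ereal) \<Rightarrow> 'a \<Rightarrow> real \<Rightarrow> 'a" where
  "fb_step f g x \<alpha> = prox (\<lambda>y. ereal \<alpha> * g y) (x - \<alpha> *\<^sub>R grad f x)"

definition line_search ::
  "('a::real_inner \<Rightarrow> ereal) \<Rightarrow> ('a \<Rightarrow> ereal) \<Rightarrow> 'a \<Rightarrow> real \<Rightarrow> real \<Rightarrow> real" where
  "line_search f g x \<sigma> \<theta> =
     while (\<lambda>\<alpha>. f (fb_step f g x \<alpha>) >
                 f x + ereal (grad f x \<bullet> (fb_step f g x \<alpha> - x)
                              + 1 / (2 * \<alpha>) * (norm (x - fb_step f g x \<alpha>))\<^sup>2))
           (\<lambda>\<alpha>. \<theta> * \<alpha>) \<sigma>"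

definition fbs_sequences ::
  "('a::real_inner \<Rightarrow> ereal) \<Rightarrow> ('a \<Rightarrow> ereal) \<Rightarrow> real \<Rightarrow> real \<Rightarrow> (nat \<Rightarrow> 'a) \<Rightarrow> (nat \<Rightarrow> real) \<Rightarrow> bool" where
  "fbs_sequences f g \<sigma> \<theta> x \<alpha> \<longleftrightarrow>
     x 0 \<in> interior (edom f) \<inter> edom g \<and>
     \<alpha> 0 = line_search f g (x 0) \<sigma> \<theta> \<and>
     (\<forall>k. \<alpha> (Suc k) = line_search f g (x (Suc k)) (\<alpha> k) \<theta>) \<and>
     (\<forall>k. x (Suc k) = fb_step f g (x k) (\<alpha> k))"

end

theory Submission
  imports Defs
begin

text \<open>
  Write \<open>S\<close> for the solution set and \<open>F\<close> for the objective. Three inequalities carry the proof.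

  An accepted forward-backward step from \<open>x\<close> to \<open>p\<close> with step size \<open>a\<close> satisfies
  \<open>2 * a * (F p - F u) \<le> (norm (x - u))\<^sup>2 - (norm (p - u))\<^sup>2\<close> for all \<open>u\<close> in \<open>interior (edom f) \<inter> edom g\<close>
  (\<open>accepted_step_decrease\<close>). The choice \<open>u = x\<close> gives descent of the values. A solution \<open>u\<close> gives
  Fejer monotonicity, by which an iterate is at most twice as far from the limit \<open>xs\<close> as from
  \<open>S\<close> (\<open>dist_le_twice_infdist\<close>).

  Metric subregularity of the subdifferential of \<open>F\<close> at \<open>xs\<close> implies the growth
  \<open>F y - F xs \<ge> \<kappa> / 4 * (infdist y S)\<^sup>2\<close> near \<open>xs\<close> (\<open>quadratic_growth\<close>), by looking at a proximal
  point of \<open>F\<close>. Inserted into the first inequality at \<open>u = xs\<close> it gives the contraction of the distances;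
  the contraction of the values follows by comparing the descent in one step with
  the upper bound for the new value (\<open>linear_rate\<close>).

  The step sizes stay large because, by the descent lemma, a trial step size up to \<open>1 / L\<close>
  is accepted whenever the gradient is Lipschitz along the step, so that a step size shortened by
  backtracking is at least \<open>\<theta> / L\<close>. With a locally Lipschitz gradient this holds from the moment
  when the iterates, and with them all trial points, are close to \<open>xs\<close> (\<open>accepts_near_solution\<close>).
  With a globally Lipschitz gradient it holds for every iterate, once the trial points are known to stay in the interior of the domain of \<open>f\<close>
  (\<open>accepts_if_globally_lipschitz\<close>).

  Since \<open>while\<close> is unspecified for loops that do not end and \<open>prox\<close> is unspecified unless the inclusion that
  defines it has exactly one solution, existence and uniqueness of proximal points and termination
  of the line search (\<open>small_steps_accepted\<close>) belong to the proof.
\<close>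

section \<open>Lower semicontinuous extended-real functions\<close>

lemma lsc_fun_eventually_gt:
  assumes "lsc_fun f" "c < f x"
  shows "\<forall>\<^sub>F y in nhds x. c < f y"
proof -
  have "c < Liminf (at x) f"
    using assms by (meson lsc_fun_def order_less_le_trans)
  then show ?thesis
    using assms(2) by (auto simp: eventually_nhds_conv_at intro: less_LiminfD)
qed

lemma lsc_funI:
  assumes "\<And>x c. c < f x \<Longrightarrow> \<forall>\<^sub>F y in nhds x. c < f y"
  shows "lsc_fun f"
  using assms unfolding lsc_fun_def le_Liminf_iff eventually_nhds_conv_at by blast

lemma open_superlevel_lsc: "lsc_fun f \<Longrightarrow> open {y. c < f y}"
  by (subst open_subopen)
    (use lsc_fun_eventually_gt[of f c] in \<open>fastforce simp: eventually_nhds\<close>)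

lemma closed_sublevel_lsc: "lsc_fun f \<Longrightarrow> closed {y. f y \<le> c}"
  using open_superlevel_lsc[of f c] by (simp add: closed_def Compl_eq not_le)

lemma lsc_fun_add:
  assumes "lsc_fun f" "lsc_fun g" "\<And>y. f y \<noteq> -\<infinity>" "\<And>y. g y \<noteq> -\<infinity>"
  shows "lsc_fun (\<lambda>y. f y + g y)"
proof (rule lsc_funI)
  fix x and c :: ereal
  assume c: "c < f x + g x"
  show "\<forall>\<^sub>F y in nhds x. c < f y + g y"
  proof (cases c)
    case (real r)
    have "c - f x < g x"
      using c real assms(3)[of x] assms(4)[of x] by (cases "f x"; cases "g x") auto
    then obtain b where b: "c - f x < ereal b" "ereal b < g x"
      using ereal_dense2 by blast
    then have a: "ereal (r - b) < f x"
      using real assms(3)[of x] by (cases "f x") auto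
    show ?thesis
      using lsc_fun_eventually_gt[OF assms(1) a] lsc_fun_eventually_gt[OF assms(2) b(2)]
    proof eventually_elim
      case (elim y)
      then have "ereal (r - b) + ereal b < f y + g y"
        by (rule ereal_add_strict_mono2)
      then show ?case using real by simp
    qed
  next
    case PInf
    then show ?thesis using c by simp
  next
    case MInf
    have "c < f y + g y" for y
      using MInf assms(3)[of y] assms(4)[of y] by (cases "f y"; cases "g y") auto
    then show ?thesis by simp
  qed
qed

lemma lsc_fun_continuous:
  fixes q :: "'a::t2_space \<Rightarrow> real"
  assumes "continuous_on UNIV q"
  shows "lsc_fun (\<lambda>y. ereal (q y))"
proof (rule lsc_funI)
  fix x and c :: ereal assume "c < ereal (q x)"
  moreover have "((\<lambda>y. ereal (q y)) \<longlongrightarrow> ereal (q x)) (nhds x)"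
    using assms by (simp add: continuous_on_eq_continuous_at isCont_def tendsto_at_iff_tendsto_nhds)
  ultimately show "\<forall>\<^sub>F y in nhds x. c < ereal (q y)"
    using order_tendstoD(1) by blast
qed

text \<open>
  Otherwise the open sets \<open>{z. h y < h z}\<close> cover the compact sublevel set, and in a finite
  subcover the index with the least value of \<open>h\<close> is covered by none of its members.
\<close>

lemma lsc_fun_attains_min:
  fixes h :: "'a::heine_borel \<Rightarrow> ereal"
  assumes lsc: "lsc_fun h" and bdd: "bounded {y. h y \<le> h c}"
  obtains p where "\<And>y. h p \<le> h y"
proof -
  let ?K = "{y. h y \<le> h c}"
  have comp: "compact ?K"
    using bdd closed_sublevel_lsc[OF lsc] by (simp add: compact_eq_bounded_closed)
  have "\<exists>p\<in>?K. \<forall>y\<in>?K. h p \<le> h y"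
  proof (rule ccontr)
    assume neg: "\<not> ?thesis"
    then have "?K \<subseteq> \<Union> ((\<lambda>y. {z. h y < h z}) ` ?K)"
      by (auto simp: not_le)
    then obtain C where C: "C \<subseteq> ?K" "finite C" "?K \<subseteq> \<Union> ((\<lambda>y. {z. h y < h z}) ` C)"
      using compactE_image[OF comp, of ?K "\<lambda>y. {z. h y < h z}"] open_superlevel_lsc[OF lsc]
      by blast
    have "C \<noteq> {}" using C(3) by auto
    then obtain m where "m \<in> C" "\<And>y. y \<in> C \<Longrightarrow> h m \<le> h y"
      using C(2) by (metis (no_types, lifting) arg_min_if_finite(1) arg_min_least)
    then show False using C by (fastforce simp: not_less)
  qed
  then obtain p where "h p \<le> h c" "\<And>y. h y \<le> h c \<Longrightarrow> h p \<le> h y" by blast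
  then have "h p \<le> h y" for y
    by (meson linear order_trans)
  then show thesis using that by blast
qed

section \<open>Subgradients\<close>

lemma subdiff_le:
  assumes "w \<in> subdiff G p" "G p = ereal a" "G y = ereal b"
  shows "a + w \<bullet> (y - p) \<le> b"
  using assms by (auto simp: subdiff_def) (metis ereal_less_eq(3) plus_ereal.simps(1))

lemma subdiff_finite:
  assumes "w \<in> subdiff G p" "\<And>y. G y \<noteq> -\<infinity>"
  obtains a where "G p = ereal a"
  using assms by (cases "G p") (auto simp: subdiff_def edom_def)

lemma subdiff_monotone:
  assumes "v \<in> subdiff G p" "w \<in> subdiff G q" "\<And>y. G y \<noteq> -\<infinity>"
  shows "(v - w) \<bullet> (p - q) \<ge> 0"
proof -
  obtain a b where ab: "G p = ereal a" "G q = ereal b"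
    using subdiff_finite assms by metis
  show ?thesis
    using subdiff_le[OF assms(1) ab] subdiff_le[OF assms(2) ab(2,1)]
    by (simp add: inner_diff_left inner_diff_right)
qed

text \<open>
  Along the segment from \<open>p\<close> to \<open>y\<close>, convexity bounds the difference quotients of \<open>G\<close> at \<open>p\<close> by
  \<open>G y - G p\<close>, and the support condition puts those of \<open>q\<close> below them; in the limit the
  directional derivative of \<open>q\<close> is at most \<open>G y - G p\<close>. With \<open>q = G\<close> this says that a gradient is a
  subgradient, and with \<open>q = - h\<close> it is Fermat's rule for a minimizer of \<open>G + h\<close>.
\<close>

lemma subgradient_of_local_support:
  fixes G :: "'a::real_inner \<Rightarrow> ereal"
  assumes conv: "convex_fun G" and ninf: "\<And>y. G y \<noteq> -\<infinity>" and fin: "G p = ereal a"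
    and q: "GDERIV q p :> D"
    and supp: "\<forall>\<^sub>F y in nhds p. ereal (a + q y - q p) \<le> G y"
  shows "D \<in> subdiff G p"
proof -
  have "G p + ereal (D \<bullet> (y - p)) \<le> G y" for y
  proof (cases "G y")
    case (real b)
    let ?c = "\<lambda>t. p + t *\<^sub>R (y - p)"
    have c0: "((\<lambda>t. ?c t) \<longlongrightarrow> p) (at_right 0)"
      by (auto intro!: tendsto_eq_intros)
    have "((\<lambda>t. q (?c t)) has_derivative (\<lambda>t. (t *\<^sub>R (y - p)) \<bullet> D)) (at 0)"
    proof (rule has_derivative_compose[where g = q and f = ?c])
      show "(?c has_derivative (\<lambda>t. t *\<^sub>R (y - p))) (at 0)"
        by (auto intro!: derivative_eq_intros)
      show "(q has_derivative (\<lambda>h. h \<bullet> D)) (at (?c 0))"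
        using q by (simp add: gderiv_def)
    qed
    then have "((\<lambda>t. q (?c t)) has_field_derivative (D \<bullet> (y - p))) (at 0)"
      unfolding has_field_derivative_def
      by (rule has_derivative_eq_rhs) (simp add: fun_eq_iff inner_commute mult.commute)
    then have "((\<lambda>t. (q (?c t) - q p) / t) \<longlongrightarrow> D \<bullet> (y - p)) (at_right 0)"
      unfolding DERIV_def by (auto intro: filterlim_at_within_not_equal tendsto_within_subset)
    moreover have "\<forall>\<^sub>F t in at_right 0. (q (?c t) - q p) / t \<le> b - a"
    proof -
      have "\<forall>\<^sub>F t in at_right 0. ereal (a + q (?c t) - q p) \<le> G (?c t)"
        using c0 supp by (rule eventually_compose_filterlim[rotated])
      moreover have "\<forall>\<^sub>F t in at_right (0::real). 0 < t \<and> t < 1"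
        using eventually_at_right_real[of 0 1] by (auto elim: eventually_mono)
      ultimately show ?thesis
      proof eventually_elim
        case (elim t)
        have "?c t = (1 - t) *\<^sub>R p + t *\<^sub>R y" by (simp add: algebra_simps)
        then have "G (?c t) \<le> ereal (1 - t) * G p + ereal t * G y"
          using conv elim unfolding convex_fun_def by (metis atLeastAtMost_iff less_imp_le)
        with elim(1) have "ereal (a + q (?c t) - q p) \<le> ereal ((1 - t) * a + t * b)"
          using fin real by (metis order_trans plus_ereal.simps(1) times_ereal.simps(1))
        then show ?case using elim(2) by (simp add: field_simps)
      qed
    qed
    ultimately have "D \<bullet> (y - p) \<le> b - a"
      by (rule tendsto_upperbound) simp
    then show ?thesis using fin real by simp
  qed (use ninf fin in auto)
  then show ?thesis using fin by (simp add: subdiff_def edom_def)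
qed

section \<open>Proximal points\<close>

text \<open>
  The point is the minimizer of \<open>G y + (norm (y - z))\<^sup>2 / (2 * a)\<close>. An affine minorant of \<open>G\<close> is
  all that coercivity requires; it is supplied by the subgradient \<open>v\<close>, since completing the
  square then encloses the relevant sublevel set in a ball around \<open>z - a *\<^sub>R v\<close>.
\<close>

lemma proximal_subgradient_exists:
  fixes G :: "'a::euclidean_space \<Rightarrow> ereal"
  assumes G: "G \<in> Gamma0" and v: "v \<in> subdiff G c" and a: "a > 0"
  obtains p where "(1 / a) *\<^sub>R (z - p) \<in> subdiff G p"
proof -
  have lsc: "lsc_fun G" and conv: "convex_fun G" and ninf: "\<And>y. G y \<noteq> -\<infinity>"
    using G by (auto simp: Gamma0_def proper_fun_def)
  let ?h = "\<lambda>y. G y + ereal ((norm (y - z))\<^sup>2 / (2 * a))"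
  obtain gc where gc: "G c = ereal gc" using subdiff_finite[OF v ninf] .
  have "lsc_fun ?h"
    by (intro lsc_fun_add lsc lsc_fun_continuous) (use ninf a in \<open>auto intro!: continuous_intros\<close>)
  moreover have "{y. ?h y \<le> ?h c} \<subseteq> cball (z - a *\<^sub>R v) (norm (c - (z - a *\<^sub>R v)))"
  proof safe
    fix y assume y: "?h y \<le> ?h c"
    obtain b where b: "G y = ereal b"
      using y gc ninf[of y] by (cases "G y") auto
    have "v \<bullet> (y - c) + (norm (y - z))\<^sup>2 / (2 * a) \<le> (norm (c - z))\<^sup>2 / (2 * a)"
      using subdiff_le[OF v gc b] y gc b by simp
    then have "2 * a * (v \<bullet> (y - c) + (norm (y - z))\<^sup>2 / (2 * a))
        \<le> 2 * a * ((norm (c - z))\<^sup>2 / (2 * a))"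
      using a by (intro mult_left_mono) auto
    then have "2 * a * (v \<bullet> (y - c)) + (norm (y - z))\<^sup>2 \<le> (norm (c - z))\<^sup>2"
      using a by (simp add: distrib_left)
    then have "(norm (y - (z - a *\<^sub>R v)))\<^sup>2 \<le> (norm (c - (z - a *\<^sub>R v)))\<^sup>2"
      unfolding power2_norm_eq_inner
      by (simp add: inner_diff_left inner_diff_right inner_add_left inner_add_right
          inner_commute algebra_simps)
    then show "y \<in> cball (z - a *\<^sub>R v) (norm (c - (z - a *\<^sub>R v)))"
      by (simp add: dist_norm norm_minus_commute power2_le_iff_abs_le)
  qed
  then have "bounded {y. ?h y \<le> ?h c}"
    using bounded_cball bounded_subset by blast
  ultimately obtain p where p: "\<And>y. ?h p \<le> ?h y"
    using lsc_fun_attains_min[of ?h c] by blast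
  obtain gp where gp: "G p = ereal gp"
    using p[of c] gc ninf[of p] by (cases "G p") auto
  have "((\<lambda>y. (- 1 / (2 * a)) * ((y - z) \<bullet> (y - z))) has_derivative
          (\<lambda>h. (- 1 / (2 * a)) * ((p - z) \<bullet> h + h \<bullet> (p - z)))) (at p)"
    by (intro has_derivative_mult_right has_derivative_inner) (auto intro!: derivative_eq_intros)
  moreover have "(- 1 / (2 * a)) * ((p - z) \<bullet> h + h \<bullet> (p - z)) = h \<bullet> ((1 / a) *\<^sub>R (z - p))"
    for h
    using a unfolding inner_scaleR_right inner_diff_left inner_diff_right
    by (simp add: inner_commute[of p h] inner_commute[of z h] field_simps)
  ultimately have "((\<lambda>y. - ((norm (y - z))\<^sup>2 / (2 * a))) has_derivative
          (\<lambda>h. h \<bullet> ((1 / a) *\<^sub>R (z - p)))) (at p)"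
    unfolding power2_norm_eq_inner by simp
  then have "(1 / a) *\<^sub>R (z - p) \<in> subdiff G p"
  proof (intro subgradient_of_local_support[OF conv ninf gp] always_eventually allI)
    fix y
    show "ereal (gp + - ((norm (y - z))\<^sup>2 / (2 * a)) - - ((norm (p - z))\<^sup>2 / (2 * a))) \<le> G y"
      using p[of y] gp ninf[of y] by (cases "G y") auto
  qed (simp add: gderiv_def)
  then show thesis using that by blast
qed

lemma subdiff_scale:
  assumes "a > 0" "\<And>y. G y \<noteq> -\<infinity>"
  shows "w \<in> subdiff (\<lambda>y. ereal a * G y) p \<longleftrightarrow> (1 / a) *\<^sub>R w \<in> subdiff G p"
proof -
  have "ereal a * G p + ereal (w \<bullet> (y - p)) \<le> ereal a * G y \<longleftrightarrow>
        G p + ereal ((1 / a) *\<^sub>R w \<bullet> (y - p)) \<le> G y" for y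
    using assms(1) assms(2)[of y] assms(2)[of p]
    by (cases "G y"; cases "G p") (auto simp: field_simps)
  moreover have "p \<in> edom (\<lambda>y. ereal a * G y) \<longleftrightarrow> p \<in> edom G"
    using assms(1) assms(2)[of p] by (cases "G p") (auto simp: edom_def)
  ultimately show ?thesis by (simp add: subdiff_def)
qed

lemma prox_eqI:
  assumes a: "a > 0" and ninf: "\<And>y. G y \<noteq> -\<infinity>"
    and p: "(1 / a) *\<^sub>R (z - p) \<in> subdiff G p"
  shows "prox (\<lambda>y. ereal a * G y) z = p"
proof -
  have mem: "q \<in> inv_map (\<lambda>p. (+) p ` subdiff (\<lambda>y. ereal a * G y) p) z \<longleftrightarrow>
        (1 / a) *\<^sub>R (z - q) \<in> subdiff G q" for q
  proof -
    have "z \<in> (+) q ` subdiff (\<lambda>y. ereal a * G y) q \<longleftrightarrow> z - q \<in> subdiff (\<lambda>y. ereal a * G y) q"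
      by (force simp: image_iff)
    then show ?thesis
      by (simp add: inv_map_def subdiff_scale[OF a ninf])
  qed
  have "q = p" if q: "(1 / a) *\<^sub>R (z - q) \<in> subdiff G q" for q
  proof -
    have "(1 / a) *\<^sub>R (z - p) - (1 / a) *\<^sub>R (z - q) = - ((1 / a) *\<^sub>R (p - q))"
      by (simp add: algebra_simps)
    then have "(p - q) \<bullet> (p - q) / a \<le> 0"
      using subdiff_monotone[OF p q ninf] by simp
    then have "(p - q) \<bullet> (p - q) \<le> 0"
      using a by (simp add: divide_le_0_iff)
    then have "(p - q) \<bullet> (p - q) = 0"
      by (intro order_antisym inner_ge_zero)
    then show ?thesis by simp
  qed
  then have "inv_map (\<lambda>p. (+) p ` subdiff (\<lambda>y. ereal a * G y) p) z = {p}"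
    using mem p by blast
  then show ?thesis by (simp add: prox_def)
qed

text \<open>
  The scaled residual \<open>norm (x - p) / a\<close> of a proximal gradient step cannot increase with the
  step size. With \<open>A\<close>, \<open>B\<close> the two scaled residual vectors, monotonicity of the subdifferential
  and Cauchy--Schwarz give \<open>0 \<le> (norm A - norm B) * (b * norm B - a * norm A)\<close>, and
  \<open>norm A < norm B\<close> would make the second factor positive. The lemma keeps short
  steps from a nonstationary point from being much shorter than their step size.
\<close>

lemma proximal_residual_antimono:
  assumes ninf: "\<And>y. G y \<noteq> -\<infinity>" and ab: "0 < a" "a \<le> b"
    and p: "(1 / a) *\<^sub>R (x - p) - d \<in> subdiff G p"
    and q: "(1 / b) *\<^sub>R (x - q) - d \<in> subdiff G q"
  shows "norm (x - q) / b \<le> norm (x - p) / a"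
proof (rule ccontr)
  define A where "A = (1 / a) *\<^sub>R (x - p)"
  define B where "B = (1 / b) *\<^sub>R (x - q)"
  have A: "norm A = norm (x - p) / a" and B: "norm B = norm (x - q) / b"
    using ab by (simp_all add: A_def B_def)
  assume "\<not> ?thesis"
  then have lt: "norm A < norm B" unfolding A B by simp
  have pq: "p - q = b *\<^sub>R B - a *\<^sub>R A" using ab by (simp add: A_def B_def)
  have "(A - d - (B - d)) \<bullet> (p - q) \<ge> 0"
    using subdiff_monotone[OF p q ninf] unfolding A_def B_def .
  then have "0 \<le> (A - B) \<bullet> (b *\<^sub>R B - a *\<^sub>R A)"
    by (simp add: pq)
  also have "\<dots> = (a + b) * (A \<bullet> B) - a * (norm A)\<^sup>2 - b * (norm B)\<^sup>2"
    unfolding power2_norm_eq_inner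
    by (simp add: inner_diff_left inner_diff_right inner_commute[of B A] algebra_simps)
  also have "\<dots> \<le> (a + b) * (norm A * norm B) - a * (norm A)\<^sup>2 - b * (norm B)\<^sup>2"
    using ab norm_cauchy_schwarz[of A B] by (simp add: mult_left_mono)
  also have "\<dots> = (norm A - norm B) * (b * norm B - a * norm A)"
    by (simp add: algebra_simps power2_eq_square)
  finally have "b * norm B \<le> a * norm A"
    using lt by (simp add: zero_le_mult_iff)
  also have "\<dots> \<le> b * norm A" using ab by (simp add: mult_right_mono)
  finally show False using lt ab by simp
qed

section \<open>The descent lemma and backtracking\<close>

text \<open>
  The difference of the two sides, along the segment, has a derivative of constant sign by the
  Lipschitz bound. Hypotheses on the segment alone are essential here: \<open>q\<close> will be the real part of
  a function that may be infinite elsewhere.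
\<close>

lemma descent_lemma_segment:
  fixes x y :: "'a::real_inner"
  assumes der: "\<And>u. u \<in> closed_segment x y \<Longrightarrow> GDERIV q u :> D u"
    and lip: "\<And>u. u \<in> closed_segment x y \<Longrightarrow> norm (D u - D x) \<le> L * norm (u - x)"
  shows "q y \<le> q x + D x \<bullet> (y - x) + L / 2 * (norm (y - x))\<^sup>2"
proof -
  let ?d = "y - x"
  let ?c = "\<lambda>t. x + t *\<^sub>R ?d"
  let ?\<phi> = "\<lambda>t. q (?c t) - t * (D x \<bullet> ?d) - L / 2 * t\<^sup>2 * (norm ?d)\<^sup>2"
  have "?\<phi> 1 \<le> ?\<phi> 0"
  proof (rule DERIV_nonpos_imp_nonincreasing[of 0 1 ?\<phi>])
    fix t :: real assume t: "0 \<le> t" "t \<le> 1"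
    have seg: "?c t \<in> closed_segment x y"
      unfolding in_segment using t by (intro exI[of _ t]) (simp add: algebra_simps)
    have "((\<lambda>t. q (?c t)) has_derivative (\<lambda>s. (s *\<^sub>R ?d) \<bullet> D (?c t))) (at t)"
      by (rule has_derivative_compose[where g = q and f = ?c])
        (use der[OF seg] in \<open>auto simp: gderiv_def intro!: derivative_eq_intros\<close>)
    then have *: "((\<lambda>t. q (?c t)) has_field_derivative (D (?c t) \<bullet> ?d)) (at t)"
      unfolding has_field_derivative_def
      by (rule has_derivative_eq_rhs) (simp add: fun_eq_iff inner_commute mult.commute)
    have "(?\<phi> has_field_derivative
        (D (?c t) \<bullet> ?d - D x \<bullet> ?d - L * t * (norm ?d)\<^sup>2)) (at t)"
      by (rule derivative_eq_intros * refl | simp)+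
    moreover have "D (?c t) \<bullet> ?d - D x \<bullet> ?d - L * t * (norm ?d)\<^sup>2 \<le> 0"
    proof -
      have "(D (?c t) - D x) \<bullet> ?d \<le> norm (D (?c t) - D x) * norm ?d"
        by (rule norm_cauchy_schwarz)
      also have "\<dots> \<le> (L * (t * norm ?d)) * norm ?d"
        using lip[OF seg] t by (intro mult_right_mono) auto
      finally show ?thesis by (simp add: inner_diff_left power2_eq_square algebra_simps)
    qed
    ultimately show "\<exists>z. (?\<phi> has_real_derivative z) (at t) \<and> z \<le> 0" by blast
  qed simp
  then show ?thesis by simp
qed

text \<open>
  The unfolding equation of \<^const>\<open>while\<close> holds unconditionally, but it pins down the result only
  if the loop ends; this is where termination of the line search has to enter.
\<close>

lemma while_backtracking:
  fixes s \<theta> :: real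
  assumes "\<exists>n. \<not> b (\<theta> ^ n * s)"
  obtains n where "while b (\<lambda>a. \<theta> * a) s = \<theta> ^ n * s" "\<not> b (\<theta> ^ n * s)"
    "\<And>m. m < n \<Longrightarrow> b (\<theta> ^ m * s)"
proof -
  define n where "n = (LEAST n. \<not> b (\<theta> ^ n * s))"
  have n: "\<not> b (\<theta> ^ n * s)" unfolding n_def using assms by (rule LeastI_ex)
  have below: "b (\<theta> ^ m * s)" if "m < n" for m
    using not_less_Least that unfolding n_def by blast
  have shift: "while b (\<lambda>a. \<theta> * a) s = while b (\<lambda>a. \<theta> * a) (\<theta> ^ m * s)" if "m \<le> n" for m
    using that
  proof (induction m)
    case (Suc m)
    have "while b (\<lambda>a. \<theta> * a) (\<theta> ^ m * s) = while b (\<lambda>a. \<theta> * a) (\<theta> ^ Suc m * s)"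
      using below[of m] Suc.prems by (subst while_unfold) (simp add: mult.assoc)
    then show ?case using Suc by simp
  qed simp
  have "while b (\<lambda>a. \<theta> * a) (\<theta> ^ n * s) = \<theta> ^ n * s"
    using n by (subst while_unfold) simp
  then have "while b (\<lambda>a. \<theta> * a) s = \<theta> ^ n * s"
    using shift[of n] by simp
  then show thesis using n below by (rule that)
qed

section \<open>Gradients and proximal gradient steps\<close>

lemma GDERIV_unique:
  assumes "GDERIV q x :> D" "GDERIV q x :> E"
  shows "D = E"
proof -
  have "(\<lambda>h. h \<bullet> D) = (\<lambda>h. h \<bullet> E)"
    using assms unfolding gderiv_def by (rule has_derivative_unique)
  then show ?thesis by (metis vector_eq_ldot)
qed

lemma GDERIV_grad: "grad_exists f x \<Longrightarrow> GDERIV (\<lambda>y. real_of_ereal (f y)) x :> grad f x"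
  unfolding grad_exists_def grad_def by (metis (no_types, lifting) GDERIV_unique theI)

lemma convex_edom:
  assumes "convex_fun f"
  shows "convex (edom f)"
proof (rule convexI)
  fix x y and u v :: real
  assume *: "x \<in> edom f" "y \<in> edom f" "0 \<le> u" "0 \<le> v" "u + v = 1"
  then have "f (u *\<^sub>R x + v *\<^sub>R y) \<le> ereal u * f x + ereal v * f y"
    using assms unfolding convex_fun_def
    by (metis add_diff_cancel_right' atLeastAtMost_iff le_add_same_cancel2)
  also have "\<dots> < \<infinity>"
    using * by (cases "f x"; cases "f y"; cases "u = 0"; cases "v = 0") (auto simp: edom_def)
  finally show "u *\<^sub>R x + v *\<^sub>R y \<in> edom f" by (simp add: edom_def)
qed

text \<open>
  The standing assumptions together with one solution. Because \<open>f\<close> is differentiable at the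
  solution \<open>xs\<close>, the locale yields the subgradient \<open>- grad f xs\<close> of \<open>g\<close> and hence
  well-definedness of all proximal steps.
\<close>

locale composite_minimization =
  fixes f g :: "'a::euclidean_space \<Rightarrow> ereal" and xs :: 'a
  assumes f_Gamma0: "f \<in> Gamma0" and g_Gamma0: "g \<in> Gamma0"
    and domain_nonempty: "interior (edom f) \<inter> edom g \<noteq> {}"
    and sublevel_subset: "\<And>u. u \<in> interior (edom f) \<inter> edom g \<Longrightarrow>
          {y. objective f g y \<le> objective f g u} \<subseteq> interior (edom f) \<inter> edom g"
    and sublevel_differentiable: "\<And>u y. u \<in> interior (edom f) \<inter> edom g \<Longrightarrow>
          objective f g y \<le> objective f g u \<Longrightarrow> cont_differentiable_at f y"
    and solution: "xs \<in> solution_set f g"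
begin

abbreviation D :: "'a set" where "D \<equiv> interior (edom f) \<inter> edom g"
abbreviation F :: "'a \<Rightarrow> ereal" where "F \<equiv> objective f g"
abbreviation fr :: "'a \<Rightarrow> real" where "fr y \<equiv> real_of_ereal (f y)"
abbreviation gr :: "'a \<Rightarrow> real" where "gr y \<equiv> real_of_ereal (g y)"
abbreviation Fr :: "'a \<Rightarrow> real" where "Fr y \<equiv> real_of_ereal (F y)"
abbreviation step :: "'a \<Rightarrow> real \<Rightarrow> 'a" where "step \<equiv> fb_step f g"

lemma f_basic: "lsc_fun f" "convex_fun f" "f y \<noteq> -\<infinity>"
  and g_basic: "lsc_fun g" "convex_fun g" "g y \<noteq> -\<infinity>"
  using f_Gamma0 g_Gamma0 by (auto simp: Gamma0_def proper_fun_def)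

lemma F_not_MInf: "F y \<noteq> -\<infinity>"
  using f_basic(3)[of y] g_basic(3)[of y] by (simp add: objective_def)

lemma finite_on_D:
  assumes "y \<in> D"
  shows "f y = ereal (fr y)" "g y = ereal (gr y)" "F y = ereal (Fr y)" "Fr y = fr y + gr y"
proof -
  have "f y < \<infinity>" "g y < \<infinity>"
    using assms interior_subset by (auto simp: edom_def)
  then show "f y = ereal (fr y)" "g y = ereal (gr y)" "F y = ereal (Fr y)" "Fr y = fr y + gr y"
    using f_basic(3)[of y] g_basic(3)[of y]
    by (cases "f y"; cases "g y"; simp add: objective_def)+
qed

lemma F_lsc: "lsc_fun F"
  unfolding objective_def by (intro lsc_fun_add f_basic g_basic)

lemma F_minimal: "F xs \<le> F y"
  using solution by (simp add: solution_set_def)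

lemma xs_in_D: "xs \<in> D"
  using domain_nonempty sublevel_subset F_minimal by blast

lemma F_convex: "convex_fun F"
  unfolding convex_fun_def
proof (intro allI ballI)
  fix x y and t :: real assume t: "t \<in> {0..1}"
  have "F ((1 - t) *\<^sub>R x + t *\<^sub>R y)
      \<le> (ereal (1 - t) * f x + ereal t * f y) + (ereal (1 - t) * g x + ereal t * g y)"
    unfolding objective_def
    using t f_basic(2) g_basic(2) unfolding convex_fun_def by (intro add_mono) blast+
  also have "\<dots> = ereal (1 - t) * F x + ereal t * F y"
    using t f_basic(3)[of x] f_basic(3)[of y] g_basic(3)[of x] g_basic(3)[of y]
    by (cases "t = 0"; cases "t = 1"; cases "f x"; cases "f y"; cases "g x"; cases "g y")
      (auto simp: objective_def algebra_simps)
  finally show "F ((1 - t) *\<^sub>R x + t *\<^sub>R y) \<le> ereal (1 - t) * F x + ereal t * F y" .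
qed

lemma F_Gamma0: "F \<in> Gamma0"
  using F_lsc F_convex F_not_MInf finite_on_D(3)[OF xs_in_D]
  by (auto simp: Gamma0_def proper_fun_def intro!: exI[of _ xs])

lemma solution_set_eq: "solution_set f g = inv_map (subdiff F) 0"
proof -
  have "edom F \<inter> {y. \<forall>z. F y \<le> F z} = {y. \<forall>z. F y \<le> F z}"
    using finite_on_D(3)[OF xs_in_D] by (auto simp: edom_def)
  then show ?thesis
    by (auto simp: solution_set_def inv_map_def subdiff_def)
qed

lemma differentiable_on_D:
  assumes "y \<in> D"
  shows "\<forall>\<^sub>F u in nhds y. grad_exists f u" "isCont (grad f) y" "grad_exists f y"
  using sublevel_differentiable[OF assms order_refl] eventually_nhds_x_imp_x
  by (auto simp: cont_differentiable_at_def)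

lemma grad_subgradient:
  assumes "grad_exists f u"
  shows "grad f u \<in> subdiff f u"
proof -
  have fin: "f y = ereal (fr y)" if "y \<in> edom f" for y
    using that f_basic(3)[of y] by (cases "f y") (auto simp: edom_def)
  have u: "u \<in> interior (edom f)" using assms by (simp add: grad_exists_def)
  then have "\<forall>\<^sub>F y in nhds u. y \<in> interior (edom f)"
    by (intro eventually_nhds_in_open) auto
  then have "\<forall>\<^sub>F y in nhds u. ereal (fr u + fr y - fr u) \<le> f y"
  proof eventually_elim
    case (elim y)
    then have "f y = ereal (fr y)" using interior_subset by (intro fin) blast
    then show ?case by (cases "f y") auto
  qed
  then show ?thesis
    using subgradient_of_local_support[OF f_basic(2,3) fin GDERIV_grad[OF assms]] u interior_subset
    by blast
qed

lemma optimality_condition: "- grad f xs \<in> subdiff g xs"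
proof -
  have "\<forall>\<^sub>F y in nhds xs. y \<in> interior (edom f)"
    using xs_in_D by (intro eventually_nhds_in_open) auto
  then have "\<forall>\<^sub>F y in nhds xs. ereal (gr xs + - fr y - - fr xs) \<le> g y"
  proof eventually_elim
    case (elim y)
    then have "f y = ereal (fr y)"
      using f_basic(3)[of y] interior_subset by (cases "f y") (auto simp: edom_def)
    then show ?case
      using F_minimal[of y] finite_on_D[OF xs_in_D] g_basic(3)[of y]
      by (cases "f y"; cases "g y"; cases "f xs"; cases "g xs") (auto simp: objective_def)
  qed
  then show ?thesis
    using GDERIV_grad[OF differentiable_on_D(3)[OF xs_in_D]]
    by (intro subgradient_of_local_support[where q = "\<lambda>y. - fr y", OF g_basic(2,3) finite_on_D(2)[OF xs_in_D]]
        GDERIV_minus)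
qed

lemma step_subgradient:
  assumes a: "a > 0"
  shows "(1 / a) *\<^sub>R (x - step x a) - grad f x \<in> subdiff g (step x a)"
proof -
  obtain p where p: "(1 / a) *\<^sub>R ((x - a *\<^sub>R grad f x) - p) \<in> subdiff g p"
    using proximal_subgradient_exists[OF g_Gamma0 optimality_condition a] .
  then have "step x a = p"
    unfolding fb_step_def by (intro prox_eqI a g_basic)
  then show ?thesis using p a by (simp add: algebra_simps)
qed

lemma step_finite: "a > 0 \<Longrightarrow> g (step x a) = ereal (gr (step x a))"
  using subdiff_finite[OF step_subgradient[of a x]] g_basic(3)
  by (metis real_of_ereal.simps(1))

text \<open>
  Compare, by monotonicity, the subgradient of \<open>g\<close> generated by the step with \<open>- grad f xs\<close>.
  The bound keeps every trial point of the line search close to \<open>xs\<close> when \<open>x\<close> is.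
\<close>

lemma step_dist_to_solution:
  assumes a: "a > 0"
  shows "norm (step x a - xs) \<le> norm (x - xs) + a * norm (grad f x - grad f xs)"
proof -
  let ?p = "step x a" and ?e = "grad f x - grad f xs"
  have "0 \<le> ((1 / a) *\<^sub>R (x - ?p) - grad f x - - grad f xs) \<bullet> (?p - xs)"
    by (rule subdiff_monotone[OF step_subgradient[OF a] optimality_condition g_basic(3)])
  then have "0 \<le> a * (((1 / a) *\<^sub>R (x - ?p) - grad f x - - grad f xs) \<bullet> (?p - xs))"
    using a by simp
  also have "\<dots> = (a *\<^sub>R ((1 / a) *\<^sub>R (x - ?p) - grad f x - - grad f xs)) \<bullet> (?p - xs)"
    by simp
  also have "a *\<^sub>R ((1 / a) *\<^sub>R (x - ?p) - grad f x - - grad f xs)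
      = (x - xs) - a *\<^sub>R ?e - (?p - xs)"
    using a by (simp add: algebra_simps)
  finally have "(norm (?p - xs))\<^sup>2 \<le> ((x - xs) - a *\<^sub>R ?e) \<bullet> (?p - xs)"
    by (simp add: inner_diff_left power2_norm_eq_inner)
  also have "\<dots> \<le> norm ((x - xs) - a *\<^sub>R ?e) * norm (?p - xs)"
    by (rule norm_cauchy_schwarz)
  finally have "norm (?p - xs) \<le> norm ((x - xs) - a *\<^sub>R ?e)"
    by (cases "?p = xs") (auto simp: power2_eq_square)
  also have "\<dots> \<le> norm (x - xs) + a * norm ?e"
    using a norm_triangle_ineq4[of "x - xs" "a *\<^sub>R ?e"] by simp
  finally show ?thesis .
qed

section \<open>The line search\<close>

text \<open>
  The negated loop condition of \<^const>\<open>line_search\<close>.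
\<close>

definition accepts :: "'a \<Rightarrow> real \<Rightarrow> bool" where
  "accepts x a \<longleftrightarrow> f (step x a) \<le> f x + ereal (grad f x \<bullet> (step x a - x)
      + 1 / (2 * a) * (norm (x - step x a))\<^sup>2)"

text \<open>
  Add the acceptance test, the gradient inequality of \<open>f\<close> at \<open>x\<close> and the subgradient inequality of
  \<open>g\<close> at the new point \<open>p\<close>; the inner product \<open>(x - p) \<bullet> (u - p)\<close> that remains is a combination of
  squared distances. For \<open>u = x\<close> the objective does not increase, so \<open>p\<close> stays in a
  sublevel set contained in \<open>D\<close>; for a solution \<open>u\<close> the distance to \<open>u\<close> does not increase.
\<close>

lemma accepted_step_decrease:
  assumes x: "x \<in> D" and a: "a > 0" and acc: "accepts x a"
  shows "step x a \<in> D"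
    and "u \<in> D \<Longrightarrow> 2 * a * (Fr (step x a) - Fr u) \<le> (norm (x - u))\<^sup>2 - (norm (step x a - u))\<^sup>2"
proof -
  let ?p = "step x a"
  have fp: "f ?p = ereal (fr ?p)"
    using acc finite_on_D(1)[OF x] f_basic(3)[of ?p]
    unfolding accepts_def by (cases "f ?p"; cases "f x") auto
  have gp: "g ?p = ereal (gr ?p)" using step_finite[OF a] .
  have Fp: "F ?p = ereal (fr ?p + gr ?p)"
    using fp gp by (metis objective_def plus_ereal.simps(1))
  have f_le: "fr ?p \<le> fr x + grad f x \<bullet> (?p - x) + 1 / (2 * a) * (norm (x - ?p))\<^sup>2"
    using acc fp finite_on_D(1)[OF x]
    unfolding accepts_def by (cases "f ?p"; cases "f x") auto
  have main: "2 * a * (fr ?p + gr ?p - Fr u) \<le> (norm (x - u))\<^sup>2 - (norm (?p - u))\<^sup>2"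
    if u: "u \<in> D" for u
  proof -
    have "gr ?p + ((1 / a) *\<^sub>R (x - ?p) - grad f x) \<bullet> (u - ?p) \<le> gr u"
      by (rule subdiff_le[OF step_subgradient[OF a] gp finite_on_D(2)[OF u]])
    moreover have "fr x + grad f x \<bullet> (u - x) \<le> fr u"
      by (rule subdiff_le[OF grad_subgradient[OF differentiable_on_D(3)[OF x]]
            finite_on_D(1)[OF x] finite_on_D(1)[OF u]])
    moreover have "grad f x \<bullet> (u - x) = grad f x \<bullet> (u - ?p) + grad f x \<bullet> (?p - x)"
      by (simp add: inner_diff_right)
    ultimately have "fr ?p + gr ?p - Fr u
        \<le> 1 / (2 * a) * (norm (x - ?p))\<^sup>2 - (1 / a) * ((x - ?p) \<bullet> (u - ?p))"
      using f_le finite_on_D(4)[OF u] by (simp add: inner_diff_left)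
    then have "2 * a * (fr ?p + gr ?p - Fr u)
        \<le> 2 * a * (1 / (2 * a) * (norm (x - ?p))\<^sup>2 - (1 / a) * ((x - ?p) \<bullet> (u - ?p)))"
      using a by (intro mult_left_mono) auto
    also have "\<dots> = (norm (x - ?p))\<^sup>2 - 2 * ((x - ?p) \<bullet> (u - ?p))"
      using a by (simp add: right_diff_distrib)
    also have "\<dots> = (norm (x - u))\<^sup>2 - (norm (?p - u))\<^sup>2"
    proof -
      have "(norm (v - w))\<^sup>2 = (norm v)\<^sup>2 - 2 * (v \<bullet> w) + (norm w)\<^sup>2" for v w :: 'a
        by (simp add: power2_norm_eq_inner inner_diff_left inner_diff_right inner_commute[of w v])
      from this[of "x - ?p" "u - ?p"]
      show ?thesis by (simp add: norm_minus_commute)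
    qed
    finally show ?thesis .
  qed
  have "2 * a * (fr ?p + gr ?p - Fr x) \<le> 0"
    using main[OF x] by (simp add: order_trans)
  then have "F ?p \<le> F x"
    using a Fp finite_on_D(3)[OF x] by (cases "F x") (auto simp: mult_le_0_iff)
  then show pD: "?p \<in> D" using sublevel_subset[OF x] by blast
  show "u \<in> D \<Longrightarrow> 2 * a * (Fr ?p - Fr u) \<le> (norm (x - u))\<^sup>2 - (norm (?p - u))\<^sup>2"
    using main finite_on_D(4)[OF pD] by simp
qed

text \<open>
  Steps shrink with the step size: with \<open>r = norm (x - step x a)\<close>, the subgradient inequality
  at \<open>step x a\<close> and the affine minorant of \<open>g\<close> at \<open>xs\<close> give \<open>r\<^sup>2 \<le> a * (A + B * r)\<close>. The constant \<open>M\<close>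
  turns this into \<open>r \<le> a * M\<close> as long as \<open>e \<le> r\<close>.
\<close>

lemma step_near:
  assumes x: "x \<in> D" and e: "e > 0"
  obtains \<delta> where "\<delta> > 0" "\<And>a. 0 < a \<Longrightarrow> a < \<delta> \<Longrightarrow> norm (x - step x a) < e"
proof -
  define A where "A = gr x - gr xs + grad f xs \<bullet> (x - xs)"
  define B where "B = norm (grad f x - grad f xs)"
  define M where "M = \<bar>A\<bar> / e + B + 1"
  have M: "M > 0" unfolding M_def B_def using e by (intro add_nonneg_pos add_nonneg_nonneg) auto
  have "norm (x - step x a) < e" if a: "0 < a" "a < e / M" for a
  proof (rule ccontr)
    let ?p = "step x a"
    let ?r = "norm (x - ?p)"
    assume "\<not> ?thesis"
    then have r: "e \<le> ?r" by simp
    have "gr ?p + ((1 / a) *\<^sub>R (x - ?p) - grad f x) \<bullet> (x - ?p) \<le> gr x"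
      by (rule subdiff_le[OF step_subgradient[OF a(1)] step_finite[OF a(1)] finite_on_D(2)[OF x]])
    moreover have "gr xs + - grad f xs \<bullet> (?p - xs) \<le> gr ?p"
      by (rule subdiff_le[OF optimality_condition finite_on_D(2)[OF xs_in_D] step_finite[OF a(1)]])
    ultimately have "?r\<^sup>2 / a \<le> A + (grad f x - grad f xs) \<bullet> (x - ?p)"
      unfolding A_def power2_norm_eq_inner
      by (simp add: inner_diff_left inner_diff_right diff_divide_distrib)
    also have "\<dots> \<le> A + B * ?r"
      using norm_cauchy_schwarz[of "grad f x - grad f xs" "x - ?p"] by (simp add: B_def)
    also have "\<dots> \<le> \<bar>A\<bar> / e * ?r + B * ?r"
    proof -
      have "\<bar>A\<bar> * e \<le> \<bar>A\<bar> * ?r" using r by (intro mult_left_mono) auto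
      then have "\<bar>A\<bar> \<le> \<bar>A\<bar> / e * ?r" using e by (simp add: field_simps)
      then show ?thesis by linarith
    qed
    also have "\<dots> \<le> M * ?r" by (simp add: M_def distrib_right)
    finally have "?r * ?r \<le> (a * M) * ?r"
      using a by (simp add: power2_eq_square field_simps)
    then have "?r \<le> a * M" by (rule mult_right_le_imp_le) (use r e in linarith)
    also have "\<dots> < e" using a M by (simp add: field_simps)
    finally show False using r by simp
  qed
  then show thesis using that[of "e / M"] e M by simp
qed

text \<open>
  By convexity the linearization error of \<open>f\<close> at \<open>p = step x a\<close> is at most
  \<open>norm (grad f p - grad f x) * norm (p - x)\<close>. Unless \<open>x\<close> is stationary, \<open>norm (p - x) \<ge> c * a\<close> with \<open>c > 0\<close>
  for small \<open>a\<close>, whereas the gradient difference tends to \<open>0\<close> by continuity and so drops below \<open>c / 2\<close>.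
\<close>

lemma small_steps_accepted:
  assumes x: "x \<in> D"
  obtains \<delta> where "\<delta> > 0" "\<And>a. 0 < a \<Longrightarrow> a < \<delta> \<Longrightarrow> accepts x a"
proof (cases "\<exists>b>0. step x b \<noteq> x")
  case False
  then have "accepts x a" if "0 < a" for a
    using that finite_on_D(1)[OF x] by (auto simp: accepts_def)
  then show thesis using that[of 1] by simp
next
  case True
  then obtain b where b: "b > 0" "step x b \<noteq> x" by blast
  define c where "c = norm (x - step x b) / b"
  have c: "c > 0" using b by (simp add: c_def)
  \<comment> \<open>The factor 1/2 leaves exactly the quadratic term of the acceptance test.\<close>
  have "\<forall>\<^sub>F u in nhds x. dist (grad f u) (grad f x) < c / 2"
    using differentiable_on_D(2)[OF x] c unfolding isCont_def tendsto_at_iff_tendsto_nhds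
    by (intro tendstoD) auto
  then have "\<forall>\<^sub>F u in nhds x. grad_exists f u \<and> dist (grad f u) (grad f x) < c / 2"
    using differentiable_on_D(1)[OF x] by eventually_elim auto
  then obtain e where e: "e > 0"
    and near: "\<And>u. dist u x < e \<Longrightarrow> grad_exists f u \<and> dist (grad f u) (grad f x) < c / 2"
    unfolding eventually_nhds_metric by blast
  obtain \<delta> where \<delta>: "\<delta> > 0" "\<And>a. 0 < a \<Longrightarrow> a < \<delta> \<Longrightarrow> norm (x - step x a) < e"
    by (rule step_near[OF x e]) blast
  have "accepts x a" if a: "0 < a" "a < min \<delta> b" for a
  proof -
    let ?p = "step x a"
    let ?r = "norm (x - ?p)"
    have gp: "grad_exists f ?p" "norm (grad f ?p - grad f x) < c / 2"
      using near[of ?p] \<delta>(2)[of a] a by (auto simp: dist_norm norm_minus_commute)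
    have "?p \<in> edom f" using gp(1) interior_subset by (auto simp: grad_exists_def)
    then have fp: "f ?p = ereal (fr ?p)"
      using f_basic(3)[of ?p] by (cases "f ?p") (auto simp: edom_def)
    have "c \<le> ?r / a"
      unfolding c_def using a
      by (intro proximal_residual_antimono[OF g_basic(3) _ _ step_subgradient step_subgradient]) auto
    then have "c * ?r \<le> ?r / a * ?r" by (intro mult_right_mono) auto
    have "fr ?p + grad f ?p \<bullet> (x - ?p) \<le> fr x"
      by (rule subdiff_le[OF grad_subgradient[OF gp(1)] fp finite_on_D(1)[OF x]])
    then have "fr ?p \<le> fr x + grad f x \<bullet> (?p - x) + (grad f ?p - grad f x) \<bullet> (?p - x)"
      by (simp add: inner_diff_left inner_diff_right)
    also have "(grad f ?p - grad f x) \<bullet> (?p - x) \<le> norm (grad f ?p - grad f x) * ?r"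
      using norm_cauchy_schwarz[of "grad f ?p - grad f x" "?p - x"] by (simp add: norm_minus_commute)
    also have "\<dots> \<le> c / 2 * ?r"
      using gp(2) by (intro mult_right_mono) auto
    also have "\<dots> \<le> 1 / (2 * a) * ?r\<^sup>2"
      using \<open>c * ?r \<le> ?r / a * ?r\<close> by (simp add: power2_eq_square)
    finally have "fr ?p \<le> fr x + (grad f x \<bullet> (?p - x) + 1 / (2 * a) * ?r\<^sup>2)" by simp
    then show ?thesis
      using fp finite_on_D(1)[OF x] unfolding accepts_def
      by (metis ereal_less_eq(3) plus_ereal.simps(1))
  qed
  then show thesis using that[of "min \<delta> b"] \<delta> b by simp
qed

lemma line_search_spec:
  assumes x: "x \<in> D" and s: "s > 0" and \<theta>: "0 < \<theta>" "\<theta> < 1"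
  defines "a \<equiv> line_search f g x s \<theta>"
  shows "0 < a" "a \<le> s" "accepts x a"
    and "a = s \<or> (a / \<theta> \<le> s \<and> \<not> accepts x (a / \<theta>))"
proof -
  obtain \<delta> where \<delta>: "\<delta> > 0" "\<And>a. 0 < a \<Longrightarrow> a < \<delta> \<Longrightarrow> accepts x a"
    by (rule small_steps_accepted[OF x]) blast
  have "(\<lambda>n. \<theta> ^ n * s) \<longlonglongrightarrow> 0 * s"
    using \<theta> by (intro tendsto_mult tendsto_const LIMSEQ_realpow_zero) auto
  then have "\<forall>\<^sub>F n in sequentially. \<theta> ^ n * s < \<delta>"
    using \<delta>(1) by (intro order_tendstoD(2)) auto
  then obtain m where "\<theta> ^ m * s < \<delta>"
    by (auto simp: eventually_sequentially)
  then have "\<exists>n. \<not> (\<not> accepts x (\<theta> ^ n * s))"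
    using \<delta>(2)[of "\<theta> ^ m * s"] \<theta> s by auto
  then obtain n where n: "while (\<lambda>a. \<not> accepts x a) (\<lambda>a. \<theta> * a) s = \<theta> ^ n * s"
    "\<not> \<not> accepts x (\<theta> ^ n * s)" "\<And>m. m < n \<Longrightarrow> \<not> accepts x (\<theta> ^ m * s)"
    by (rule while_backtracking) blast
  have a: "a = \<theta> ^ n * s"
    unfolding a_def line_search_def n(1)[symmetric] accepts_def not_le ..
  show "0 < a" "accepts x a" using a n \<theta> s by auto
  have pow: "\<theta> ^ m * s \<le> s" for m
    using \<theta> s by (intro mult_left_le_one_le) (auto simp: power_le_one)
  then show "a \<le> s" using a by simp
  show "a = s \<or> (a / \<theta> \<le> s \<and> \<not> accepts x (a / \<theta>))"
  proof (cases n)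
    case (Suc m)
    then have "a / \<theta> = \<theta> ^ m * s" using a \<theta> by simp
    then show ?thesis using n(3)[of m] pow[of m] Suc by simp
  qed (use a in simp)
qed

lemma accepts_if_lipschitz_segment:
  assumes x: "x \<in> D" and a: "a > 0" "a * L \<le> 1"
    and diff: "\<And>u. u \<in> closed_segment x (step x a) \<Longrightarrow> grad_exists f u"
    and lip: "\<And>u. u \<in> closed_segment x (step x a) \<Longrightarrow>
        norm (grad f u - grad f x) \<le> L * norm (u - x)"
  shows "accepts x a"
proof -
  let ?p = "step x a"
  have "?p \<in> edom f" using diff[of ?p] interior_subset by (auto simp: grad_exists_def)
  then have fp: "f ?p = ereal (fr ?p)"
    using f_basic(3)[of ?p] by (cases "f ?p") (auto simp: edom_def)
  have "fr ?p \<le> fr x + grad f x \<bullet> (?p - x) + L / 2 * (norm (?p - x))\<^sup>2"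
    using GDERIV_grad[OF diff] lip by (rule descent_lemma_segment)
  also have "L / 2 * (norm (?p - x))\<^sup>2 \<le> 1 / (2 * a) * (norm (?p - x))\<^sup>2"
    using a by (intro mult_right_mono) (auto simp: field_simps)
  finally have "fr ?p \<le> fr x + (grad f x \<bullet> (?p - x) + 1 / (2 * a) * (norm (x - ?p))\<^sup>2)"
    by (simp add: norm_minus_commute)
  then show ?thesis
    using fp finite_on_D(1)[OF x] unfolding accepts_def
    by (metis ereal_less_eq(3) plus_ereal.simps(1))
qed

section \<open>Acceptance of steps under Lipschitz gradients\<close>

lemma D_convex: "convex D"
  using f_basic(2) g_basic(2) by (simp add: convex_Int convex_interior convex_edom)

text \<open>
  The descent lemma needs the segment from \<open>x\<close> to \<open>p = step x a\<close> to stay in \<open>D\<close>, although \<open>p\<close> is a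
  priori only known to lie in the domain of \<open>g\<close>. On the part of the segment inside the interior of the
  domain of \<open>f\<close> the descent lemma gives \<open>F \<le> F x\<close>, and conversely that sublevel set lies in \<open>D\<close>.
  This part is therefore relatively open and, by lower semicontinuity, relatively closed, so it is everything.
\<close>

lemma accepts_if_globally_lipschitz:
  assumes x: "x \<in> D" and a: "a > 0" "a * L \<le> 1" and L: "L-lipschitz_on D (grad f)"
  shows "accepts x a"
proof -
  let ?p = "step x a"
  let ?c = "\<lambda>t. x + t *\<^sub>R (?p - x)"
  have lip: "norm (grad f u - grad f x) \<le> L * norm (u - x)" if "u \<in> D" for u
    using lipschitz_onD[OF L that x] by (simp add: dist_norm)
  have gp: "g ?p = ereal (gr ?p)" using step_finite[OF a(1)] .
  have c_eq: "?c t = (1 - t) *\<^sub>R x + t *\<^sub>R ?p" for t by (simp add: algebra_simps)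
  have g_seg: "g (?c t) \<le> ereal ((1 - t) * gr x + t * gr ?p)" if "t \<in> {0..1}" for t
  proof -
    have "g (?c t) \<le> ereal (1 - t) * g x + ereal t * g ?p"
      unfolding c_eq using g_basic(2) that unfolding convex_fun_def by blast
    then show ?thesis
      using gp finite_on_D(2)[OF x] by (metis plus_ereal.simps(1) times_ereal.simps(1))
  qed
  have model: "gr ?p - gr x + grad f x \<bullet> (?p - x) \<le> - (norm (?p - x))\<^sup>2 / a"
    using subdiff_le[OF step_subgradient[OF a(1), of x] gp finite_on_D(2)[OF x]]
    by (simp add: power2_norm_eq_inner inner_diff_left inner_diff_right diff_divide_distrib)
  have seg_D: "?c t \<in> D" if t: "t \<in> {0..1}" "?c t \<in> interior (edom f)" for t
    using t g_seg[OF t(1)] by (auto simp: edom_def intro: order_le_less_trans)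
  have below: "F (?c t) \<le> F x" if t: "t \<in> {0..1}" "?c t \<in> interior (edom f)" for t
  proof -
    note cD = seg_D[OF t]
    have sub: "closed_segment x (?c t) \<subseteq> D"
      using D_convex x cD by (rule closed_segment_subset[rotated 2])
    have "fr (?c t) \<le> fr x + grad f x \<bullet> (?c t - x) + L / 2 * (norm (?c t - x))\<^sup>2"
      by (rule descent_lemma_segment) (use sub GDERIV_grad differentiable_on_D(3) lip in blast)+
    then have "fr (?c t) \<le> fr x + t * (grad f x \<bullet> (?p - x)) + L / 2 * t\<^sup>2 * (norm (?p - x))\<^sup>2"
      by (simp add: power_mult_distrib)
    moreover have "gr (?c t) \<le> gr x + t * (gr ?p - gr x)"
      using g_seg[OF t(1)] finite_on_D(2)[OF cD] by (cases "g (?c t)") (auto simp: algebra_simps)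
    moreover have "t * (gr ?p - gr x) + t * (grad f x \<bullet> (?p - x)) \<le> - (t * ((norm (?p - x))\<^sup>2 / a))"
      using mult_left_mono[OF model, of t] t by (simp add: distrib_left)
    moreover have "L / 2 * t\<^sup>2 * (norm (?p - x))\<^sup>2 \<le> t * ((norm (?p - x))\<^sup>2 / a)"
    proof -
      have "L * t\<^sup>2 \<le> L * t"
        using t lipschitz_on_nonneg[OF L] by (intro mult_left_mono) (auto simp: power2_eq_square mult_left_le)
      moreover have "L * t \<le> 1 / a * t"
        using a t by (intro mult_right_mono) (auto simp: field_simps)
      moreover have "0 \<le> L * t\<^sup>2" using lipschitz_on_nonneg[OF L] by simp
      ultimately have "L / 2 * t\<^sup>2 \<le> 1 / a * t" by linarith
      then have "L / 2 * t\<^sup>2 * (norm (?p - x))\<^sup>2 \<le> 1 / a * t * (norm (?p - x))\<^sup>2"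
        by (rule mult_right_mono) simp
      then show ?thesis by (simp add: mult.commute)
    qed
    ultimately have "Fr (?c t) \<le> Fr x"
      unfolding finite_on_D(4)[OF cD] finite_on_D(4)[OF x] by linarith
    then show ?thesis
      using finite_on_D(3)[OF cD] finite_on_D(3)[OF x] by (metis ereal_less_eq(3))
  qed
  \<comment> \<open>The parameters whose point is interior to the domain of \<open>f\<close> form a clopen subset of the unit interval.\<close>
  let ?T = "{0..1} \<inter> ?c -` interior (edom f)"
  have cont: "continuous_on {0..1} ?c" by (intro continuous_intros)
  have "?T = {0..1} \<inter> ?c -` {y. F y \<le> F x}"
    using below sublevel_subset[OF x] by auto
  then have "closedin (top_of_set {0..1}) ?T"
    using continuous_closedin_preimage[OF cont closed_sublevel_lsc[OF F_lsc]] by metis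
  moreover have "openin (top_of_set {0..1}) ?T"
    by (rule continuous_openin_preimage_gen[OF cont open_interior])
  moreover have "0 \<in> ?T" using x by simp
  ultimately have "?T = {0..1}"
    using connected_Icc[of 0 "1::real"] unfolding connected_clopen by blast
  then have "1 \<in> ?T" by simp
  then have "?p \<in> D" using seg_D[of 1] by simp
  then have "closed_segment x ?p \<subseteq> D"
    using D_convex x by (intro closed_segment_subset)
  then show ?thesis
    using differentiable_on_D(3) lip by (intro accepts_if_lipschitz_segment[OF x a]) blast+
qed

lemma accepts_near_solution:
  assumes lip: "locally_lipschitz_around L (grad f) xs" and s: "s > 0"
  obtains e where "e > 0"
    "\<And>x a. x \<in> D \<Longrightarrow> dist x xs < e \<Longrightarrow> 0 < a \<Longrightarrow> a \<le> s \<Longrightarrow> a * L \<le> 1 \<Longrightarrow> accepts x a"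
proof -
  obtain U where U: "open U" "xs \<in> U" "L-lipschitz_on U (grad f)"
    using lip by (auto simp: locally_lipschitz_around_def)
  have "\<forall>\<^sub>F u in nhds xs. u \<in> U \<and> grad_exists f u"
    using eventually_nhds_in_open[OF U(1,2)] differentiable_on_D(1)[OF xs_in_D]
    by eventually_elim auto
  then obtain r where r: "r > 0" and near: "\<And>u. dist u xs < r \<Longrightarrow> u \<in> U \<and> grad_exists f u"
    unfolding eventually_nhds_metric by blast
  have L: "L \<ge> 0" using lipschitz_on_nonneg[OF U(3)] .
  then have pos: "1 + s * L > 0" using s by (simp add: add_pos_nonneg)
  \<comment> \<open>Trial points are at most \<open>1 + s * L\<close> times as far from \<open>xs\<close> as \<open>x\<close>.\<close>
  have "accepts x a"
    if x: "x \<in> D" and d: "dist x xs < r / (1 + s * L)" and a: "0 < a" "a \<le> s" "a * L \<le> 1" for x a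
  proof -
    have small: "dist x xs * (1 + s * L) < r" using d pos by (simp add: field_simps)
    have "dist x xs * 1 \<le> dist x xs * (1 + s * L)"
      using s L by (intro mult_left_mono) auto
    then have xr: "dist x xs < r" using small by simp
    have "dist (step x a) xs \<le> dist x xs + a * norm (grad f x - grad f xs)"
      using step_dist_to_solution[OF a(1)] by (simp add: dist_norm)
    also have "a * norm (grad f x - grad f xs) \<le> s * (L * dist x xs)"
      using lipschitz_onD[OF U(3), of x xs] near[OF xr] U(2) a s
      by (intro mult_mono) (auto simp: dist_norm)
    finally have "dist (step x a) xs < r" using small by (simp add: algebra_simps)
    then have "closed_segment x (step x a) \<subseteq> ball xs r"
      using xr by (intro closed_segment_subset) (auto simp: dist_commute)
    then have seg: "u \<in> U \<and> grad_exists f u" if "u \<in> closed_segment x (step x a)" for u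
      using that near[of u] by (auto simp: dist_commute)
    show ?thesis
      by (rule accepts_if_lipschitz_segment[OF x a(1,3)])
        (use seg near[OF xr] lipschitz_onD[OF U(3)] in \<open>auto simp: dist_norm\<close>)
  qed
  then show thesis using that[of "r / (1 + s * L)"] r pos by simp
qed

section \<open>Quadratic growth from metric subregularity\<close>

text \<open>
  Take the proximal point \<open>u\<close> of \<open>y\<close> with \<open>\<kappa> *\<^sub>R (y - u)\<close> a subgradient of \<open>F\<close> at \<open>u\<close>. Subregularity
  bounds the distance of \<open>u\<close> to the solutions by \<open>norm (y - u)\<close>, so \<open>y\<close> is within \<open>2 * norm (y - u)\<close>
  of them, and the subgradient inequality gives \<open>F y - F u \<ge> \<kappa> * (norm (y - u))\<^sup>2\<close>. A proximal
  parameter \<open>\<tau>\<close> in place of \<open>\<kappa>\<close> would yield the constant \<open>\<tau> / (1 + \<tau> / \<kappa>)\<^sup>2\<close>, which is largest for \<open>\<tau> = \<kappa>\<close>.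
\<close>

lemma quadratic_growth:
  assumes \<kappa>: "\<kappa> > 0" and sr: "metrically_subregular (subdiff F) xs 0 (inverse \<kappa>)"
  shows "\<forall>\<^sub>F y in nhds xs. y \<in> D \<longrightarrow>
           \<kappa> / 4 * (infdist y (solution_set f g))\<^sup>2 \<le> Fr y - Fr xs"
proof -
  let ?S = "solution_set f g"
  obtain e where e: "e > 0"
    and reg: "\<And>u. dist u xs < e \<Longrightarrow> ext_dist u ?S \<le> ereal (inverse \<kappa>) * ext_dist 0 (subdiff F u)"
    using sr unfolding metrically_subregular_def eventually_nhds_metric solution_set_eq by blast
  have zero: "0 \<in> subdiff F xs"
    using solution unfolding solution_set_eq by (simp add: inv_map_def)
  have "\<kappa> / 4 * (infdist y ?S)\<^sup>2 \<le> Fr y - Fr xs" if y: "y \<in> D" "dist y xs < e" for y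
  proof -
    obtain u where "(1 / (1 / \<kappa>)) *\<^sub>R (y - u) \<in> subdiff F u"
      using proximal_subgradient_exists[OF F_Gamma0 zero, of "1 / \<kappa>"] \<kappa> by auto
    then have u: "\<kappa> *\<^sub>R (y - u) \<in> subdiff F u" by simp
    obtain b where b: "F u = ereal b" using subdiff_finite[OF u F_not_MInf] .
    have "0 \<le> (\<kappa> *\<^sub>R (y - u) - 0) \<bullet> (u - xs)"
      by (rule subdiff_monotone[OF u zero F_not_MInf])
    then have "0 \<le> (y - u) \<bullet> (u - xs)" using \<kappa> by (simp add: zero_le_mult_iff)
    also have "(y - u) \<bullet> (u - xs) = (y - xs) \<bullet> (u - xs) - (norm (u - xs))\<^sup>2"
      by (simp add: power2_norm_eq_inner inner_diff_left)
    finally have "(norm (u - xs))\<^sup>2 \<le> norm (y - xs) * norm (u - xs)"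
      using norm_cauchy_schwarz[of "y - xs" "u - xs"] by linarith
    then have "norm (u - xs) \<le> norm (y - xs)"
      by (cases "u = xs") (auto simp: power2_eq_square)
    then have ue: "dist u xs < e" using y by (simp add: dist_norm)
    have "ext_dist 0 (subdiff F u) \<le> ereal (dist 0 (\<kappa> *\<^sub>R (y - u)))"
      unfolding ext_dist_def using u by (rule INF_lower)
    then have "ereal (inverse \<kappa>) * ext_dist 0 (subdiff F u)
        \<le> ereal (inverse \<kappa>) * ereal (dist 0 (\<kappa> *\<^sub>R (y - u)))"
      using \<kappa> by (intro ereal_mult_left_mono) auto
    also have "\<dots> = ereal (dist y u)" using \<kappa> by (simp add: dist_norm)
    finally have "ext_dist u ?S \<le> ereal (dist y u)" using reg[OF ue] by (rule order_trans[rotated])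
    moreover have "ereal (infdist u ?S) \<le> ext_dist u ?S"
      unfolding ext_dist_def by (rule INF_greatest) (simp add: infdist_le)
    ultimately have "infdist u ?S \<le> dist y u" by (metis ereal_less_eq(3) order_trans)
    then have "infdist y ?S \<le> 2 * norm (y - u)"
      using infdist_triangle[of y ?S u] by (simp add: dist_norm)
    then have "(infdist y ?S)\<^sup>2 \<le> (2 * norm (y - u))\<^sup>2"
      by (rule power_mono) (rule infdist_nonneg)
    then have "\<kappa> / 4 * (infdist y ?S)\<^sup>2 \<le> \<kappa> / 4 * (2 * norm (y - u))\<^sup>2"
      using \<kappa> by (intro mult_left_mono) auto
    also have "\<dots> = \<kappa> * (norm (y - u))\<^sup>2" by (simp add: power_mult_distrib)
    also have "\<dots> \<le> Fr y - b"
      using subdiff_le[OF u b finite_on_D(3)[OF y(1)]] by (simp add: power2_norm_eq_inner)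
    also have "\<dots> \<le> Fr y - Fr xs"
      using F_minimal[of u] b finite_on_D(3)[OF xs_in_D] by (cases "F xs") auto
    finally show ?thesis .
  qed
  then show ?thesis
    unfolding eventually_nhds_metric using e by blast
qed

end

section \<open>The forward-backward sequence\<close>

locale forward_backward = composite_minimization +
  fixes \<sigma> \<theta> :: real and x :: "nat \<Rightarrow> 'a" and \<alpha> :: "nat \<Rightarrow> real"
  assumes \<sigma>: "\<sigma> > 0" and \<theta>: "0 < \<theta>" "\<theta> < 1"
    and fbs: "fbs_sequences f g \<sigma> \<theta> x \<alpha>"
    and convergent_to_solution: "x \<longlonglongrightarrow> xs"
begin

lemma iterate_Suc: "x (Suc k) = step (x k) (\<alpha> k)"
  using fbs unfolding fbs_sequences_def by blast

lemma iterate_invariant: "x k \<in> D \<and> 0 < \<alpha> k \<and> accepts (x k) (\<alpha> k)"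
proof (induction k)
  case 0
  then show ?case
    using fbs line_search_spec[OF _ \<sigma> \<theta>, of "x 0"] by (simp add: fbs_sequences_def)
next
  case (Suc k)
  then have "x (Suc k) \<in> D"
    using accepted_step_decrease(1) by (simp add: iterate_Suc)
  then show ?case
    using Suc fbs line_search_spec[of "x (Suc k)" "\<alpha> k" \<theta>] \<theta> by (simp add: fbs_sequences_def)
qed

lemma iterate_in_D: "x k \<in> D"
  and step_size_pos: "0 < \<alpha> k"
  and step_size_accepted: "accepts (x k) (\<alpha> k)"
  using iterate_invariant[of k] by auto

lemma step_size_0:
  "\<alpha> 0 \<le> \<sigma>" "\<alpha> 0 = \<sigma> \<or> (\<alpha> 0 / \<theta> \<le> \<sigma> \<and> \<not> accepts (x 0) (\<alpha> 0 / \<theta>))"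
  using fbs line_search_spec[OF iterate_in_D \<sigma> \<theta>, of 0] by (simp_all add: fbs_sequences_def)

lemma step_size_Suc:
  "\<alpha> (Suc k) \<le> \<alpha> k"
  "\<alpha> (Suc k) = \<alpha> k \<or> (\<alpha> (Suc k) / \<theta> \<le> \<alpha> k \<and> \<not> accepts (x (Suc k)) (\<alpha> (Suc k) / \<theta>))"
  using fbs line_search_spec[OF iterate_in_D step_size_pos \<theta>, of "Suc k" k]
  by (simp_all add: fbs_sequences_def)

lemma step_size_le: "\<alpha> k \<le> \<sigma>"
  using step_size_0(1) step_size_Suc(1) by (induction k) (auto intro: order_trans)

text \<open>
  A step size shortened by the line search is \<open>\<theta>\<close> times a rejected one, and rejected ones exceed \<open>1 / L\<close>.
\<close>

lemma rejected_step_size: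
  assumes L: "L > 0" and acc: "\<And>a. 0 < a \<Longrightarrow> a \<le> \<sigma> \<Longrightarrow> a * L \<le> 1 \<Longrightarrow> accepts (x k) a"
    and rej: "\<alpha> k / \<theta> \<le> \<sigma>" "\<not> accepts (x k) (\<alpha> k / \<theta>)"
  shows "\<theta> / L \<le> \<alpha> k"
proof -
  have "\<not> \<alpha> k / \<theta> * L \<le> 1"
    using acc[of "\<alpha> k / \<theta>"] rej step_size_pos[of k] \<theta> by auto
  then show ?thesis using L \<theta> by (simp add: field_simps)
qed

lemma step_size_lower_bound:
  assumes L: "L > 0"
    and acc: "\<And>k a. K \<le> k \<Longrightarrow> 0 < a \<Longrightarrow> a \<le> \<sigma> \<Longrightarrow> a * L \<le> 1 \<Longrightarrow> accepts (x k) a"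
    and "K \<le> k"
  shows "min (\<alpha> K) (\<theta> / L) \<le> \<alpha> k"
  using \<open>K \<le> k\<close>
proof (induction k rule: dec_induct)
  case (step k)
  show ?case
  proof (cases "\<alpha> (Suc k) = \<alpha> k")
    case False
    then have "\<theta> / L \<le> \<alpha> (Suc k)"
      using step_size_Suc(2)[of k] step_size_le[of k] step.hyps
      by (intro rejected_step_size[OF L acc]) auto
    then show ?thesis by simp
  qed (use step in simp)
qed simp

lemma global_step_size_lower_bound:
  assumes L: "L > 0" "L-lipschitz_on D (grad f)"
  shows "min \<sigma> (\<theta> / L) \<le> \<alpha> k"
proof -
  have acc: "accepts (x k) a" if "0 < a" "a * L \<le> 1" for a k
    using accepts_if_globally_lipschitz[OF iterate_in_D that L(2)] .
  have "min \<sigma> (\<theta> / L) \<le> \<alpha> 0"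
  proof (cases "\<alpha> 0 = \<sigma>")
    case False
    then have "\<theta> / L \<le> \<alpha> 0"
      using step_size_0(2) acc by (intro rejected_step_size[OF L(1)]) auto
    then show ?thesis by simp
  qed simp
  then show ?thesis
    using step_size_lower_bound[OF L(1), of 0 k] acc by simp
qed

lemma step_inequality:
  "u \<in> D \<Longrightarrow> 2 * \<alpha> k * (Fr (x (Suc k)) - Fr u)
     \<le> (norm (x k - u))\<^sup>2 - (norm (x (Suc k) - u))\<^sup>2"
  using accepted_step_decrease(2)[OF iterate_in_D step_size_pos step_size_accepted]
  by (simp add: iterate_Suc)

lemma Fr_minimal: "y \<in> D \<Longrightarrow> Fr xs \<le> Fr y"
  using F_minimal[of y] finite_on_D(3)[OF xs_in_D] finite_on_D(3)[of y]
  by (metis ereal_less_eq(3))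

text \<open>
  The iterates do not move away from the solution \<open>u\<close> nearest to \<open>x k\<close>, so their limit \<open>xs\<close> is no
  farther from \<open>u\<close> than \<open>x k\<close> is. This turns growth in terms of the distance to the solution set
  into growth in terms of the distance to the particular limit \<open>xs\<close>.
\<close>

lemma dist_le_twice_infdist: "norm (x k - xs) \<le> 2 * infdist (x k) (solution_set f g)"
proof -
  let ?S = "solution_set f g"
  have "?S = {y. F y \<le> F xs}"
    using F_minimal by (auto simp: solution_set_def intro: order_trans)
  then have "closed ?S" using closed_sublevel_lsc[OF F_lsc] by simp
  then obtain u where u: "u \<in> ?S" "infdist (x k) ?S = dist (x k) u"
    using infdist_attains_inf[of ?S] solution by blast
  have "F u \<le> F xs" using u(1) by (simp add: solution_set_def)
  then have uD: "u \<in> D" using sublevel_subset[OF xs_in_D] by blast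
  have uF: "Fr u \<le> Fr y" if "y \<in> D" for y
    using u(1) finite_on_D(3)[OF uD] finite_on_D(3)[OF that]
    unfolding solution_set_def by (metis ereal_less_eq(3) mem_Collect_eq)
  have "norm (x (Suc j) - u) \<le> norm (x j - u)" for j
  proof -
    have "0 \<le> 2 * \<alpha> j * (Fr (x (Suc j)) - Fr u)"
      using uF[OF iterate_in_D[of "Suc j"]] step_size_pos[of j] by simp
    then have "(norm (x (Suc j) - u))\<^sup>2 \<le> (norm (x j - u))\<^sup>2"
      using step_inequality[OF uD, of j] by linarith
    then show ?thesis by (rule power2_le_imp_le) simp
  qed
  then have "decseq (\<lambda>j. norm (x j - u))" by (rule decseq_SucI)
  moreover have "(\<lambda>j. norm (x j - u)) \<longlonglongrightarrow> norm (xs - u)"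
    using convergent_to_solution by (intro tendsto_intros)
  ultimately have "norm (xs - u) \<le> norm (x k - u)" by (rule decseq_ge)
  then have "norm (x k - xs) \<le> 2 * norm (x k - u)"
    using norm_triangle_ineq4[of "x k - u" "xs - u"] by simp
  then show ?thesis using u(2) by (simp add: dist_norm)
qed

text \<open>
  Growth at the new iterate and \<^term>\<open>norm (x (Suc k) - xs) \<le> 2 * infdist (x (Suc k)) (solution_set f g)\<close>
  give \<open>\<kappa> / 16 * d'\<^sup>2 \<le> E'\<close>, which with \<open>2 * \<alpha> k * E' \<le> d\<^sup>2 - d'\<^sup>2\<close> and \<open>2 * a \<le> \<alpha> k\<close> yields
  \<open>(1 + a * \<kappa> / 4) * d'\<^sup>2 \<le> d\<^sup>2\<close>. For the values, the decrease satisfies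
  \<open>2 * \<alpha> k * (E - E') \<ge> (norm (x k - x (Suc k)))\<^sup>2 \<ge> (d - d')\<^sup>2\<close>; dividing by the upper bound for \<open>E'\<close>
  gives \<open>(E - E') / E' \<ge> (d - d') / (d + d') \<ge> (s - 1) / (s + 1)\<close>, the last step by \<open>d' \<le> d / s\<close>.
\<close>

lemma linear_rate:
  assumes \<kappa>: "\<kappa> > 0" and a: "a > 0" "2 * a \<le> \<alpha> k"
    and growth: "\<kappa> / 4 * (infdist (x (Suc k)) (solution_set f g))\<^sup>2 \<le> Fr (x (Suc k)) - Fr xs"
  defines "s \<equiv> sqrt (1 + a * \<kappa> / 4)"
  shows "norm (x (Suc k) - xs) \<le> 1 / s * norm (x k - xs)"
    and "\<bar>F (x (Suc k)) - F xs\<bar> \<le> ereal ((s + 1) / (2 * s)) * \<bar>F (x k) - F xs\<bar>"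
proof -
  define d d' where "d = norm (x k - xs)" and "d' = norm (x (Suc k) - xs)"
  define E E' where "E = Fr (x k) - Fr xs" and "E' = Fr (x (Suc k)) - Fr xs"
  have d: "0 \<le> d" "0 \<le> d'" by (simp_all add: d_def d'_def)
  have E: "0 \<le> E" "0 \<le> E'"
    using Fr_minimal[OF iterate_in_D] by (simp_all add: E_def E'_def)
  have s2: "s\<^sup>2 = 1 + a * \<kappa> / 4" and s1: "1 < s"
    unfolding s_def using a \<kappa> by simp_all
  have ineq: "2 * \<alpha> k * E' \<le> d\<^sup>2 - d'\<^sup>2"
    using step_inequality[OF xs_in_D] by (simp add: E'_def d_def d'_def)
  have "d'\<^sup>2 \<le> (2 * infdist (x (Suc k)) (solution_set f g))\<^sup>2"
    using dist_le_twice_infdist d(2) unfolding d'_def by (intro power_mono)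
  then have "\<kappa> / 16 * d'\<^sup>2 \<le> \<kappa> / 16 * (2 * infdist (x (Suc k)) (solution_set f g))\<^sup>2"
    using \<kappa> by (intro mult_left_mono) auto
  also have "\<dots> \<le> E'" using growth by (simp add: E'_def power_mult_distrib)
  finally have "4 * a * (\<kappa> / 16 * d'\<^sup>2) \<le> 4 * a * E'"
    using a by (intro mult_left_mono) auto
  also have "\<dots> \<le> 2 * \<alpha> k * E'"
    using a E by (intro mult_right_mono) auto
  finally have "(s * d')\<^sup>2 \<le> d\<^sup>2"
    using ineq by (simp add: power_mult_distrib s2 algebra_simps)
  then have sd: "s * d' \<le> d" by (rule power2_le_imp_le) (rule d(1))
  then show "norm (x (Suc k) - xs) \<le> 1 / s * norm (x k - xs)"
    using s1 by (simp add: d_def d'_def field_simps)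
  have desc: "(d - d')\<^sup>2 \<le> 2 * \<alpha> k * (E - E')"
  proof -
    have "(norm (x (Suc k) - x k))\<^sup>2 \<le> 2 * \<alpha> k * (E - E')"
      using step_inequality[OF iterate_in_D, of k k] by (simp add: E_def E'_def algebra_simps)
    moreover have "d - d' \<le> norm (x (Suc k) - x k)"
      using norm_triangle_ineq2[of "x k - xs" "x (Suc k) - xs"]
      by (simp add: d_def d'_def norm_minus_commute)
    moreover have "0 \<le> d - d'"
      using sd s1 d mult_right_mono[of 1 s d'] by simp
    ultimately show ?thesis by (meson order_trans power_mono)
  qed
  have "2 * s * E' \<le> (s + 1) * E"
  proof (cases "d = 0")
    case True
    then have "d' = 0" using sd s1 d by (simp add: mult_le_0_iff)
    then have "2 * \<alpha> k * E' \<le> 0" using ineq True by simp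
    then have "E' \<le> 0" using step_size_pos[of k] by (simp add: mult_le_0_iff)
    then have "E' = 0" using E by simp
    then show ?thesis using E s1 by simp
  next
    case False
    have dd: "(s - 1) * (d + d') \<le> (s + 1) * (d - d')"
      using sd by (simp add: algebra_simps)
    have "(s - 1) * (2 * \<alpha> k * E') \<le> (s - 1) * ((d + d') * (d - d'))"
      using ineq s1 by (intro mult_left_mono) (auto simp: algebra_simps power2_eq_square)
    also have "\<dots> = ((s - 1) * (d + d')) * (d - d')" by simp
    also have "\<dots> \<le> ((s + 1) * (d - d')) * (d - d')"
      using dd sd s1 d mult_right_mono[of 1 s d'] by (intro mult_right_mono) auto
    also have "\<dots> = (s + 1) * (d - d')\<^sup>2" by (simp add: power2_eq_square)
    also have "\<dots> \<le> (s + 1) * (2 * \<alpha> k * (E - E'))"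
      using desc s1 by (intro mult_left_mono) auto
    finally have "2 * \<alpha> k * ((s - 1) * E') \<le> 2 * \<alpha> k * ((s + 1) * (E - E'))"
      by (simp add: algebra_simps)
    then have "(s - 1) * E' \<le> (s + 1) * (E - E')"
      using step_size_pos[of k] by simp
    then show ?thesis by (simp add: algebra_simps)
  qed
  then have "E' \<le> (s + 1) / (2 * s) * E"
    using s1 by (simp add: field_simps)
  moreover have "F y - F xs = ereal (Fr y - Fr xs)" if "y \<in> D" for y
    using finite_on_D(3)[OF that] finite_on_D(3)[OF xs_in_D]
    by (cases "F y"; cases "F xs") auto
  then have "\<bar>F (x k) - F xs\<bar> = ereal E" "\<bar>F (x (Suc k)) - F xs\<bar> = ereal E'"
    using E iterate_in_D by (simp_all add: E_def E'_def)
  ultimately show "\<bar>F (x (Suc k)) - F xs\<bar> \<le> ereal ((s + 1) / (2 * s)) * \<bar>F (x k) - F xs\<bar>"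
    by simp
qed

end

section \<open>Linear convergence\<close>

text \<open>
  From the index \<open>K\<close> on, growth holds along the iterates and all trial step sizes up to \<open>1 / L\<close> are
  accepted. The halves in the definition of \<open>a\<close> turn the lower bound
  for the step sizes into \<open>2 * a \<le> \<alpha> k\<close>.
\<close>

theorem theorem4p2:
  fixes f g :: "real ^ 'n \<Rightarrow> ereal"
    and x :: "nat \<Rightarrow> real ^ 'n" and xs :: "real ^ 'n"
    and \<alpha> :: "nat \<Rightarrow> real" and \<sigma> \<theta> L \<kappa> :: real
  assumes A1: "f \<in> Gamma0" "g \<in> Gamma0" "interior (edom f) \<inter> edom g \<noteq> {}"
    and A2_sublevel: "\<And>u. u \<in> interior (edom f) \<inter> edom g \<Longrightarrow>
          {y. objective f g y \<le> objective f g u} \<subseteq> interior (edom f) \<inter> edom g"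
    and A2_diff: "\<And>u y. u \<in> interior (edom f) \<inter> edom g \<Longrightarrow>
          objective f g y \<le> objective f g u \<Longrightarrow> cont_differentiable_at f y"
    and "\<sigma> > 0" "0 < \<theta>" "\<theta> < 1"
    and fbs: "fbs_sequences f g \<sigma> \<theta> x \<alpha>"
    and "solution_set f g \<noteq> {}"
    and "xs \<in> solution_set f g" "x \<longlonglongrightarrow> xs"
    and "L > 0" "locally_lipschitz_around L (grad f) xs"
    and "\<kappa> > 0" "metrically_subregular (subdiff (objective f g)) xs 0 (inverse \<kappa>)"
  shows "(\<exists>K. \<forall>k>K.
            let a = min (\<alpha> K / 2) (\<theta> / (2 * L)) in
            norm (x (Suc k) - xs) \<le> 1 / sqrt (1 + a * \<kappa> / 4) * norm (x k - xs) \<and>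
            \<bar>objective f g (x (Suc k)) - objective f g xs\<bar>
              \<le> ereal ((sqrt (1 + a * \<kappa> / 4) + 1) / (2 * sqrt (1 + a * \<kappa> / 4)))
                 * \<bar>objective f g (x k) - objective f g xs\<bar>)
       \<and> (\<forall>L'>0. L'-lipschitz_on (interior (edom f) \<inter> edom g) (grad f) \<longrightarrow>
          (\<exists>K. \<forall>k>K.
            let a = min (\<sigma> / 2) (\<theta> / (2 * L')) in
            norm (x (Suc k) - xs) \<le> 1 / sqrt (1 + a * \<kappa> / 4) * norm (x k - xs) \<and>
            \<bar>objective f g (x (Suc k)) - objective f g xs\<bar>
              \<le> ereal ((sqrt (1 + a * \<kappa> / 4) + 1) / (2 * sqrt (1 + a * \<kappa> / 4)))
                 * \<bar>objective f g (x k) - objective f g xs\<bar>))"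
proof -
  interpret forward_backward f g xs \<sigma> \<theta> x \<alpha>
    by unfold_locales (use assms in blast)+
  have "\<forall>\<^sub>F k in sequentially. x k \<in> D \<longrightarrow>
      \<kappa> / 4 * (infdist (x k) (solution_set f g))\<^sup>2 \<le> Fr (x k) - Fr xs"
    using \<open>x \<longlonglongrightarrow> xs\<close> quadratic_growth[OF \<open>\<kappa> > 0\<close>
        \<open>metrically_subregular (subdiff (objective f g)) xs 0 (inverse \<kappa>)\<close>]
    by (rule eventually_compose_filterlim[rotated])
  then obtain K1 where growth: "\<And>k. K1 \<le> k \<Longrightarrow>
      \<kappa> / 4 * (infdist (x k) (solution_set f g))\<^sup>2 \<le> Fr (x k) - Fr xs"
    using iterate_in_D unfolding eventually_sequentially by blast
  have rate: "norm (x (Suc k) - xs) \<le> 1 / sqrt (1 + a * \<kappa> / 4) * norm (x k - xs) \<and>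
      \<bar>F (x (Suc k)) - F xs\<bar>
        \<le> ereal ((sqrt (1 + a * \<kappa> / 4) + 1) / (2 * sqrt (1 + a * \<kappa> / 4))) * \<bar>F (x k) - F xs\<bar>"
    if "K1 \<le> k" "a > 0" "2 * a \<le> \<alpha> k" for k a
    using linear_rate[OF \<open>\<kappa> > 0\<close> that(2,3) growth] that(1) by simp
  obtain e where e: "e > 0"
    "\<And>y a. y \<in> D \<Longrightarrow> dist y xs < e \<Longrightarrow> 0 < a \<Longrightarrow> a \<le> \<sigma> \<Longrightarrow> a * L \<le> 1 \<Longrightarrow> accepts y a"
    using accepts_near_solution[OF \<open>locally_lipschitz_around L (grad f) xs\<close> \<open>\<sigma> > 0\<close>] by blast
  obtain K2 where K2: "\<And>k. K2 \<le> k \<Longrightarrow> dist (x k) xs < e"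
    using tendstoD[OF \<open>x \<longlonglongrightarrow> xs\<close> e(1)] unfolding eventually_sequentially by blast
  define K where "K = max K1 K2"
  have bound: "min (\<alpha> K) (\<theta> / L) \<le> \<alpha> k" if "K \<le> k" for k
    using \<open>L > 0\<close> _ that by (rule step_size_lower_bound) (use e K2 iterate_in_D in \<open>auto simp: K_def\<close>)
  show ?thesis
  proof (intro conjI exI[of _ K] allI impI)
    fix k assume k: "K < k"
    let ?a = "min (\<alpha> K / 2) (\<theta> / (2 * L))"
    have "?a > 0" using step_size_pos[of K] \<open>0 < \<theta>\<close> \<open>L > 0\<close> by simp
    moreover have "2 * ?a \<le> \<alpha> k" using bound[of k] k by (simp add: min_def split: if_splits)
    ultimately show "let a = ?a in
        norm (x (Suc k) - xs) \<le> 1 / sqrt (1 + a * \<kappa> / 4) * norm (x k - xs) \<and>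
        \<bar>F (x (Suc k)) - F xs\<bar>
          \<le> ereal ((sqrt (1 + a * \<kappa> / 4) + 1) / (2 * sqrt (1 + a * \<kappa> / 4))) * \<bar>F (x k) - F xs\<bar>"
      unfolding Let_def using k by (intro rate) (simp_all add: K_def)
  next
    fix L' k assume L': "L' > 0" "L'-lipschitz_on D (grad f)" and k: "K < k"
    let ?a = "min (\<sigma> / 2) (\<theta> / (2 * L'))"
    have "?a > 0" using \<open>\<sigma> > 0\<close> \<open>0 < \<theta>\<close> L' by simp
    moreover have "2 * ?a \<le> \<alpha> k"
      using global_step_size_lower_bound[OF L', of k] by (simp add: min_def split: if_splits)
    ultimately show "let a = ?a in
        norm (x (Suc k) - xs) \<le> 1 / sqrt (1 + a * \<kappa> / 4) * norm (x k - xs) \<and>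
        \<bar>F (x (Suc k)) - F xs\<bar>
          \<le> ereal ((sqrt (1 + a * \<kappa> / 4) + 1) / (2 * sqrt (1 + a * \<kappa> / 4))) * \<bar>F (x k) - F xs\<bar>"
      unfolding Let_def using k by (intro rate) (simp_all add: K_def)
  qed
qed

end
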